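(* Let $f:M\to(N,g)$ be a pluri-harmonic map from a compact complex manifold $M$ to a compact Kähler manifold $(N,g)$. If $(N,g)$ has non-degenerate curvature and $\operatorname{rank}_{\mathbb R}df\ge 4$, then $f$ is holomorphic or anti-holomorphic.
   Context: Manifolds are connected and maps are smooth. $\operatorname{rank}_{\mathbb R}df$ denotes the maximum over $M$ of the real rank of $df$; thus $\operatorname{rank}_{\mathbb R}df\ge4$ means the rank is at least $4$ at some point. A smooth map $f:M\to(N,g)$ from a complex manifold to a Kähler manifold is pluri-harmonic if, in local holomorphic coordinates $z^\alpha$ on $M$ and $w^i$ on $N$, for all $\alpha,\beta,i$, $$\frac{\partial^2 f^i}{\partial z^\alpha\partial\bar z^\beta}+\Gamma^i_{jk}(f)\frac{\partial f^j}{\partial\bar z^\beta}\frac{\partial f^k}{\partial z^\alpha}=0,$$ where $\Gamma^i_{jk}=g^{i\bar\ell}\partial g_{k\bar\ell}/\partial w^j$ are the Christoffel symbols of the Kähler metric $g$. Curvature components of $(N,g)$, $n=\dim_{\mathbb C}N$: $R_{i\bar jk\bar\ell}=-\frac{\partial^2g_{k\bar\ell}}{\partial w^i\partial\bar w^j}+g^{p\bar q}\frac{\partial g_{k\bar q}}{\partial w^i}\frac{\partial g_{p\bar\ell}}{\partial\bar w^j}$. The curvature is non-degenerate if at every point of $N$, for all $A,B,C,D\in\mathbb C^n$, $$\sum_{i,j,k,\ell}R_{i\bar jk\bar\ell}\,(A^i\overline{B}^{j}-C^i\overline{D}^{j})\,\overline{(A^\ell\overline{B}^{k}-C^\ell\overline{D}^{k})}=0$$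 if and only if $A^i\overline{B}^{j}-C^i\overline{D}^{j}=0$ for all $i,j$. *)

theory Defs
  imports "HOL-Analysis.Analysis"
begin

section \<open>Calculus on open subsets of complex coordinate space\<close>

text \<open>The two predicates below are meant for open \<^term>\<open>S\<close> only.\<close>

primrec times_differentiable_on ::
    "nat \<Rightarrow> 'a::real_normed_vector set \<Rightarrow> ('a \<Rightarrow> 'b::real_normed_vector) \<Rightarrow> bool" where
  "times_differentiable_on 0 S f \<longleftrightarrow> continuous_on S f"
| "times_differentiable_on (Suc k) S f \<longleftrightarrow>
     (\<forall>x\<in>S. f differentiable (at x)) \<and>
     (\<forall>v. times_differentiable_on k S (\<lambda>x. frechet_derivative f (at x) v))"

definition smooth_on :: "'a::real_normed_vector set \<Rightarrow> ('a \<Rightarrow> 'b::real_normed_vector) \<Rightarrow> bool" where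
  "smooth_on S f \<longleftrightarrow> (\<forall>k. times_differentiable_on k S f)"

definition holomorphic_vec_on :: "(complex^'m) set \<Rightarrow> (complex^'m \<Rightarrow> complex^'n) \<Rightarrow> bool" where
  "holomorphic_vec_on S f \<longleftrightarrow>
     (\<forall>z\<in>S. \<exists>D. (f has_derivative D) (at z) \<and> (\<forall>c v. D (c *s v) = c *s D v))"

definition antiholomorphic_vec_on :: "(complex^'m) set \<Rightarrow> (complex^'m \<Rightarrow> complex^'n) \<Rightarrow> bool" where
  "antiholomorphic_vec_on S f \<longleftrightarrow>
     (\<forall>z\<in>S. \<exists>D. (f has_derivative D) (at z) \<and> (\<forall>c v. D (c *s v) = cnj c *s D v))"

text \<open>The Wirtinger derivatives \<open>\<partial>/\<partial>z\<^sup>\<alpha> = (\<partial>/\<partial>x\<^sup>\<alpha> - \<i> \<partial>/\<partial>y\<^sup>\<alpha>)/2\<close> and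
  \<open>\<partial>/\<partial>z\<^sup>\<alpha>\<close>-bar \<open>= (\<partial>/\<partial>x\<^sup>\<alpha> + \<i> \<partial>/\<partial>y\<^sup>\<alpha>)/2\<close>.\<close>

definition dz :: "'m \<Rightarrow> (complex^'m \<Rightarrow> complex) \<Rightarrow> complex^'m \<Rightarrow> complex" where
  "dz \<alpha> F z = (frechet_derivative F (at z) (axis \<alpha> 1)
              - \<i> * frechet_derivative F (at z) (axis \<alpha> \<i>)) / 2"

definition dzbar :: "'m \<Rightarrow> (complex^'m \<Rightarrow> complex) \<Rightarrow> complex^'m \<Rightarrow> complex" where
  "dzbar \<alpha> F z = (frechet_derivative F (at z) (axis \<alpha> 1)
                 + \<i> * frechet_derivative F (at z) (axis \<alpha> \<i>)) / 2"


section \<open>Complex manifolds and maps between them\<close>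

text \<open>A chart is a domain together with a coordinate map; the values of the coordinate map
  outside the domain are irrelevant.  An atlas need not be maximal.\<close>

type_synonym ('a, 'm) chart = "'a set \<times> ('a \<Rightarrow> complex^'m)"

definition is_chart :: "'a topology \<Rightarrow> ('a, 'm::finite) chart \<Rightarrow> bool" where
  "is_chart X = (\<lambda>(U, \<phi>). openin X U \<and> open (\<phi> ` U) \<and>
     homeomorphic_map (subtopology X U) (top_of_set (\<phi> ` U)) \<phi>)"

definition local_dom ::
    "('a, 'm) chart \<Rightarrow> ('b, 'n) chart \<Rightarrow> ('a \<Rightarrow> 'b) \<Rightarrow> (complex^'m) set" where
  "local_dom c d f = snd c ` (fst c \<inter> f -` fst d)"

definition local_rep ::
    "('a, 'm) chart \<Rightarrow> ('b, 'n) chart \<Rightarrow> ('a \<Rightarrow> 'b) \<Rightarrow> complex^'m \<Rightarrow> complex^'n" where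
  "local_rep c d f = snd d \<circ> f \<circ> inv_into (fst c) (snd c)"

locale complex_manifold =
  fixes X :: "'a topology" and A :: "('a, 'm::finite) chart set"
  assumes Hausdorff: "Hausdorff_space X"
    and second_countable: "second_countable X"
    and connected: "connected_space X"
    and charts: "c \<in> A \<Longrightarrow> is_chart X c"
    and cover: "(\<Union>c\<in>A. fst c) = topspace X"
    and transition: "\<lbrakk>c \<in> A; d \<in> A\<rbrakk> \<Longrightarrow> holomorphic_vec_on (local_dom c d id) (local_rep c d id)"

definition smooth_map ::
    "'a topology \<Rightarrow> ('a, 'm::finite) chart set \<Rightarrow> 'b topology \<Rightarrow> ('b, 'n::finite) chart set
      \<Rightarrow> ('a \<Rightarrow> 'b) \<Rightarrow> bool" where
  "smooth_map X A Y B f \<longleftrightarrow> continuous_map X Y f \<and>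
     (\<forall>c\<in>A. \<forall>d\<in>B. smooth_on (local_dom c d f) (local_rep c d f))"

definition holomorphic_map ::
    "'a topology \<Rightarrow> ('a, 'm::finite) chart set \<Rightarrow> 'b topology \<Rightarrow> ('b, 'n::finite) chart set
      \<Rightarrow> ('a \<Rightarrow> 'b) \<Rightarrow> bool" where
  "holomorphic_map X A Y B f \<longleftrightarrow> continuous_map X Y f \<and>
     (\<forall>c\<in>A. \<forall>d\<in>B. holomorphic_vec_on (local_dom c d f) (local_rep c d f))"

definition antiholomorphic_map ::
    "'a topology \<Rightarrow> ('a, 'm::finite) chart set \<Rightarrow> 'b topology \<Rightarrow> ('b, 'n::finite) chart set
      \<Rightarrow> ('a \<Rightarrow> 'b) \<Rightarrow> bool" where
  "antiholomorphic_map X A Y B f \<longleftrightarrow> continuous_map X Y f \<and>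
     (\<forall>c\<in>A. \<forall>d\<in>B. antiholomorphic_vec_on (local_dom c d f) (local_rep c d f))"

text \<open>The maximum over \<open>M\<close> of the real rank of \<open>df\<close>.  The ranks are bounded by the real dimension
  of the target, so the supremum is a maximum when \<open>M\<close> is nonempty, and it is \<open>0\<close> otherwise.\<close>

definition real_rank ::
    "('a, 'm::finite) chart set \<Rightarrow> ('b, 'n::finite) chart set \<Rightarrow> ('a \<Rightarrow> 'b) \<Rightarrow> nat" where
  "real_rank A B f =
     Sup {dim (range (frechet_derivative (local_rep c d f) (at z))) | c d z.
            c \<in> A \<and> d \<in> B \<and> z \<in> local_dom c d f}"


section \<open>Kaehler metrics\<close>

text \<open>A Hermitian metric is given by its matrices of components in the charts: the entry
  \<open>g d w $ k $ l\<close> is the component with holomorphic index \<open>k\<close> and antiholomorphic index \<open>l\<close>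
  in the chart \<open>d\<close> at the point with coordinates \<open>w\<close>.\<close>

type_synonym ('b, 'n) metric = "('b, 'n) chart \<Rightarrow> complex^'n \<Rightarrow> complex^'n^'n"

definition herm :: "complex^'n^'n \<Rightarrow> complex^'n \<Rightarrow> complex^'n \<Rightarrow> complex" where
  "herm H u v = (\<Sum>k\<in>UNIV. \<Sum>l\<in>UNIV. H $ k $ l * u $ k * cnj (v $ l))"

text \<open>The fundamental form \<open>\<omega>(u,v) = Re h(\<i>u, v)\<close> of the Hermitian form \<open>h\<close>.\<close>

definition kaehler_form :: "complex^'n^'n \<Rightarrow> complex^'n \<Rightarrow> complex^'n \<Rightarrow> real" where
  "kaehler_form H u v = - Im (herm H u v)"

text \<open>Assumption \<open>closed\<close> is \<open>d\<omega> = 0\<close>: its left-hand side is the value of \<open>d\<omega>\<close> on constant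
  vector fields \<open>u\<close>, \<open>v\<close>, \<open>x\<close>.\<close>

locale kaehler_manifold = complex_manifold Y B
  for Y :: "'b topology" and B :: "('b, 'n::finite) chart set" +
  fixes g :: "('b, 'n) metric"
  assumes smooth: "d \<in> B \<Longrightarrow> smooth_on (snd d ` fst d) (g d)"
    and hermitian: "\<lbrakk>d \<in> B; w \<in> snd d ` fst d\<rbrakk> \<Longrightarrow> g d w $ l $ k = cnj (g d w $ k $ l)"
    and positive: "\<lbrakk>d \<in> B; w \<in> snd d ` fst d; v \<noteq> 0\<rbrakk> \<Longrightarrow> 0 < Re (herm (g d w) v v)"
    and compatible: "\<lbrakk>d \<in> B; e \<in> B; w \<in> local_dom d e id;
        T = local_rep d e id; D = frechet_derivative T (at w)\<rbrakk>
        \<Longrightarrow> herm (g d w) u v = herm (g e (T w)) (D u) (D v)"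
    and closed: "\<lbrakk>d \<in> B; w \<in> snd d ` fst d\<rbrakk> \<Longrightarrow>
        frechet_derivative (\<lambda>y. kaehler_form (g d y) v x) (at w) u
      + frechet_derivative (\<lambda>y. kaehler_form (g d y) x u) (at w) v
      + frechet_derivative (\<lambda>y. kaehler_form (g d y) u v) (at w) x = 0"

text \<open>The inverse metric with upper indices \<open>i\<close>, \<open>l\<close>-bar is determined by summing to \<open>\<delta>\<close> against
  the component with indices \<open>k\<close>, \<open>l\<close>-bar over \<open>l\<close>; hence the transposition.\<close>

definition metric_inv :: "complex^'n^'n \<Rightarrow> 'n \<Rightarrow> 'n \<Rightarrow> complex" where
  "metric_inv H i l = matrix_inv H $ l $ i"

text \<open>For \<open>h = g d\<close>, the symbol with upper index \<open>i\<close> and lower indices \<open>j\<close>, \<open>k\<close>, and the curvature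
  component with indices \<open>i\<close>, \<open>j\<close>-bar, \<open>k\<close>, \<open>l\<close>-bar.\<close>

definition christoffel ::
    "(complex^'n \<Rightarrow> complex^'n^'n) \<Rightarrow> complex^'n \<Rightarrow> 'n \<Rightarrow> 'n \<Rightarrow> 'n \<Rightarrow> complex" where
  "christoffel h w i j k =
     (\<Sum>l\<in>UNIV. metric_inv (h w) i l * dz j (\<lambda>y. h y $ k $ l) w)"

definition curvature ::
    "(complex^'n \<Rightarrow> complex^'n^'n) \<Rightarrow> complex^'n \<Rightarrow> 'n \<Rightarrow> 'n \<Rightarrow> 'n \<Rightarrow> 'n \<Rightarrow> complex" where
  "curvature h w i j k l =
     - dz i (dzbar j (\<lambda>y. h y $ k $ l)) w
     + (\<Sum>p\<in>UNIV. \<Sum>q\<in>UNIV. metric_inv (h w) p q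
          * dz i (\<lambda>y. h y $ k $ q) w * dzbar j (\<lambda>y. h y $ p $ l) w)"

definition nondegenerate_curvature :: "('b, 'n::finite) chart set \<Rightarrow> ('b, 'n) metric \<Rightarrow> bool" where
  "nondegenerate_curvature B g \<longleftrightarrow>
     (\<forall>d\<in>B. \<forall>w \<in> snd d ` fst d. \<forall>a b c e :: complex^'n.
        (\<Sum>i\<in>UNIV. \<Sum>j\<in>UNIV. \<Sum>k\<in>UNIV. \<Sum>l\<in>UNIV. curvature (g d) w i j k l
            * (a $ i * cnj (b $ j) - c $ i * cnj (e $ j))
            * cnj (a $ l * cnj (b $ k) - c $ l * cnj (e $ k))) = 0
        \<longleftrightarrow> (\<forall>i j. a $ i * cnj (b $ j) - c $ i * cnj (e $ j) = 0))"

definition pluriharmonic ::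
    "('a, 'm::finite) chart set \<Rightarrow> ('b, 'n::finite) chart set \<Rightarrow> ('b, 'n) metric
      \<Rightarrow> ('a \<Rightarrow> 'b) \<Rightarrow> bool" where
  "pluriharmonic A B g f \<longleftrightarrow>
     (\<forall>c\<in>A. \<forall>d\<in>B. \<forall>z \<in> local_dom c d f. \<forall>\<alpha> \<beta> i.
        let F = local_rep c d f in
          dz \<alpha> (dzbar \<beta> (\<lambda>y. F y $ i)) z
          + (\<Sum>j\<in>UNIV. \<Sum>k\<in>UNIV. christoffel (g d) (F z) i j k
               * dzbar \<beta> (\<lambda>y. F y $ j) z * dz \<alpha> (\<lambda>y. F y $ k) z) = 0)"

end

theory Submission
  imports Defs
begin

text \<open>Commuting covariant derivatives along a pluriharmonic map \<open>f\<close> shows that the curvature annihilates the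
  tensors \<open>\<partial>\<close>-bar \<open>f\<close> \<open>\<wedge>\<close> conj \<open>\<partial> f\<close>, so these vanish by non-degeneracy. By linear algebra, where the
  real rank of \<open>df\<close> is at least \<open>3\<close> some \<open>2 \<times> 2\<close> minor of \<open>\<partial> f\<close> or of \<open>\<partial>\<close>-bar \<open>f\<close> is nonzero, and then the
  other one of the two vanishes nearby. Pluriharmonicity is a linear first-order
  Cauchy--Riemann system for \<open>\<partial>\<close>-bar \<open>f\<close> and for \<open>\<partial> f\<close>; restricted to complex lines it has unique continuation, which
  follows from monotonicity of a frequency function on concentric circles. Connectedness of \<open>M\<close> finishes the proof.\<close>

section \<open>Smooth functions\<close>

text \<open>The metric is only smooth, so \<open>f\<close> need not be real analytic and its
  derivatives cannot in general be continued by power series. This is why unique continuation has to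
  work from a bare inequality: the Cauchy--Riemann operator applied to \<open>u\<close> is bounded
  by a constant times the norm of \<open>u\<close>. Complex lines suffice because a small ball
  around the centre of a larger one meets every complex line through the centre in a disc, and every
  other point of the larger ball lies on such a line. The number 3 comes from the case that all 2 x
  2 minors vanish. Both \<partial> f and \<partial>-bar f then have rank at most one, and the wedge
  relation makes their coefficient vectors conjugate to each other, so the real differential factors
  through a single copy of the complex numbers. The two alternatives of the conclusion run in
  parallel through a parameter \<open>s\<close>, equal to \<open>\<i>\<close> or
  \<open>- \<i>\<close>. Its sign is decided at a single point of large rank and then spread over
  \<open>M\<close>; at points of small rank the wedge relation alone would leave it
  undecided.\<close>

lemma times_differentiable_on_cong:
  assumes "open S" "\<And>x. x \<in> S \<Longrightarrow> f x = g x" "times_differentiable_on k S f"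
  shows "times_differentiable_on k S g"
  using assms(2,3)
proof (induction k arbitrary: f g)
  case 0
  then show ?case by (simp cong: continuous_on_cong)
next
  case (Suc k)
  have eq: "frechet_derivative f (at x) = frechet_derivative g (at x)" and d: "g differentiable (at x)"
    if "x \<in> S" for x
  proof -
    have f: "f differentiable (at x)" using Suc.prems(2) that by simp
    show "frechet_derivative f (at x) = frechet_derivative g (at x)"
      using frechet_derivative_transform_within_open[OF f \<open>open S\<close> that] Suc.prems(1) by blast
    show "g differentiable (at x)"
      using f has_derivative_transform_within_open[of f _ x UNIV S g] \<open>open S\<close> that Suc.prems(1)
      unfolding differentiable_def by blast
  qed
  have "times_differentiable_on k S (\<lambda>x. frechet_derivative g (at x) v)" for v
    by (rule Suc.IH[of "\<lambda>x. frechet_derivative f (at x) v"]) (use eq Suc.prems(2) in auto)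
  then show ?case using d by simp
qed

lemma times_differentiable_on_SucD:
  "times_differentiable_on (Suc k) S f \<Longrightarrow> times_differentiable_on k S f"
proof (induction k arbitrary: f)
  case 0
  then have "continuous_on S f"
    by (intro continuous_at_imp_continuous_on) (auto intro: differentiable_imp_continuous_within)
  then show ?case by simp
next
  case (Suc k)
  have "times_differentiable_on k S (\<lambda>x. frechet_derivative f (at x) v)" for v
    using Suc.IH[of "\<lambda>x. frechet_derivative f (at x) v"] Suc.prems by simp
  then show ?case using Suc.prems by simp
qed

lemma times_differentiable_on_const: "times_differentiable_on k S (\<lambda>x. c)"
  by (induction k arbitrary: c) auto

text \<open>Derivatives are unique, so any explicit formula \<open>D\<close> may stand in for
  \<open>frechet_derivative\<close>, which is a choice and awkward to compute with.\<close>

lemma times_differentiable_on_SucI: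
  assumes "open S" "\<And>x. x \<in> S \<Longrightarrow> (f has_derivative D x) (at x)"
    "\<And>v. times_differentiable_on k S (\<lambda>x. D x v)"
  shows "times_differentiable_on (Suc k) S f"
proof -
  have "D x = frechet_derivative f (at x)" if "x \<in> S" for x
    using assms(2)[OF that] frechet_derivative_at by blast
  then have "times_differentiable_on k S (\<lambda>x. frechet_derivative f (at x) v)" for v
    by (intro times_differentiable_on_cong[OF assms(1) _ assms(3)]) auto
  then show ?thesis using assms(2) by (auto simp: differentiable_def)
qed

lemma times_differentiable_on_Suc_has_derivative:
  "times_differentiable_on (Suc k) S f \<Longrightarrow> x \<in> S \<Longrightarrow>
    (f has_derivative frechet_derivative f (at x)) (at x)"
  by (simp add: frechet_derivative_works[THEN iffD1])

lemma times_differentiable_on_bounded_linear_compose: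
  assumes "bounded_linear L" "open S" "times_differentiable_on k S f"
  shows "times_differentiable_on k S (\<lambda>x. L (f x))"
  using assms(3)
proof (induction k arbitrary: f)
  case 0
  then show ?case by (simp add: bounded_linear.continuous_on[OF assms(1)])
next
  case (Suc k)
  show ?case
    by (rule times_differentiable_on_SucI[OF \<open>open S\<close>])
      (use Suc in \<open>auto intro!: bounded_linear.has_derivative[OF assms(1)] frechet_derivative_works[THEN iffD1]\<close>)
qed

lemma times_differentiable_on_add:
  assumes "open S" "times_differentiable_on k S f" "times_differentiable_on k S g"
  shows "times_differentiable_on k S (\<lambda>x. f x + g x)"
  using assms(2,3)
proof (induction k arbitrary: f g)
  case 0
  then show ?case by (simp add: continuous_on_add)
next
  case (Suc k)
  show ?case
    by (rule times_differentiable_on_SucI[OF \<open>open S\<close>, of _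
          "\<lambda>x v. frechet_derivative f (at x) v + frechet_derivative g (at x) v"])
      (use Suc in \<open>auto intro!: has_derivative_add frechet_derivative_works[THEN iffD1]\<close>)
qed

lemma times_differentiable_on_sum:
  assumes "open S" "\<And>i. i \<in> I \<Longrightarrow> times_differentiable_on k S (f i)"
  shows "times_differentiable_on k S (\<lambda>x. \<Sum>i\<in>I. f i x)"
  using assms(2)
  by (induction I rule: infinite_finite_induct)
    (auto intro: times_differentiable_on_const times_differentiable_on_add[OF assms(1)])

lemma times_differentiable_on_bilinear:
  assumes "bounded_bilinear p" "open S"
    "times_differentiable_on k S f" "times_differentiable_on k S g"
  shows "times_differentiable_on k S (\<lambda>x. p (f x) (g x))"
  using assms(3,4)
proof (induction k arbitrary: f g)
  case 0
  then show ?case by (simp add: bounded_bilinear.continuous_on[OF assms(1)])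
next
  case (Suc k)
  note f = Suc.prems(1) and g = Suc.prems(2)
  show ?case
  proof (rule times_differentiable_on_SucI[OF \<open>open S\<close>])
    show "((\<lambda>x. p (f x) (g x)) has_derivative
        (\<lambda>v. p (f x) (frechet_derivative g (at x) v) + p (frechet_derivative f (at x) v) (g x))) (at x)"
      if "x \<in> S" for x
      by (intro bounded_bilinear.FDERIV[OF assms(1)]
          times_differentiable_on_Suc_has_derivative[OF f that]
          times_differentiable_on_Suc_has_derivative[OF g that])
    show "times_differentiable_on k S (\<lambda>x. p (f x) (frechet_derivative g (at x) v)
        + p (frechet_derivative f (at x) v) (g x))" for v
      using f g by (intro times_differentiable_on_add[OF \<open>open S\<close>] Suc.IH
          times_differentiable_on_SucD[OF f] times_differentiable_on_SucD[OF g]) auto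
  qed
qed

text \<open>By the chain rule \<open>h\<close> is differentiated in a direction that depends on
  \<open>x\<close>, whereas the induction hypothesis handles fixed directions. Expanding that
  direction in \<open>Basis\<close> leaves a finite sum of scalar functions times derivatives of
  \<open>h\<close> in the fixed directions \<open>b\<close>.\<close>

lemma times_differentiable_on_compose:
  fixes F :: "'a::real_normed_vector \<Rightarrow> 'b::euclidean_space" and h :: "'b \<Rightarrow> 'c::real_normed_vector"
  assumes "open S" "open T" "F ` S \<subseteq> T" "times_differentiable_on k S F" "times_differentiable_on k T h"
  shows "times_differentiable_on k S (\<lambda>x. h (F x))"
  using assms(4,5)
proof (induction k arbitrary: h)
  case 0
  then show ?case using continuous_on_compose2[OF _ _ \<open>F ` S \<subseteq> T\<close>] by simp
next
  case (Suc k)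
  note F = Suc.prems(1) and h = Suc.prems(2)
  define D where "D x v = (\<Sum>b\<in>Basis. (frechet_derivative F (at x) v \<bullet> b) *\<^sub>R frechet_derivative h (at (F x)) b)"
    for x v
  show ?case
  proof (rule times_differentiable_on_SucI[OF \<open>open S\<close>])
    fix x assume x: "x \<in> S"
    then have "F x \<in> T" using assms(3) by blast
    note hd = times_differentiable_on_Suc_has_derivative[OF h this]
    have "((\<lambda>x. h (F x)) has_derivative (\<lambda>v. frechet_derivative h (at (F x)) (frechet_derivative F (at x) v))) (at x)"
      by (rule has_derivative_compose[OF times_differentiable_on_Suc_has_derivative[OF F x] hd])
    moreover have "frechet_derivative h (at (F x)) w = (\<Sum>b\<in>Basis. (w \<bullet> b) *\<^sub>R frechet_derivative h (at (F x)) b)" for w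
    proof -
      have l: "linear (frechet_derivative h (at (F x)))" using hd has_derivative_linear by blast
      have "frechet_derivative h (at (F x)) (\<Sum>b\<in>Basis. (w \<bullet> b) *\<^sub>R b) = (\<Sum>b\<in>Basis. (w \<bullet> b) *\<^sub>R frechet_derivative h (at (F x)) b)"
        by (simp add: linear_sum[OF l] linear_cmul[OF l])
      then show ?thesis by (simp add: euclidean_representation)
    qed
    then have "D x = (\<lambda>v. frechet_derivative h (at (F x)) (frechet_derivative F (at x) v))"
      unfolding D_def by metis
    ultimately show "((\<lambda>x. h (F x)) has_derivative D x) (at x)" by simp
  next
    fix v
    show "times_differentiable_on k S (\<lambda>x. D x v)"
      unfolding D_def
    proof (intro times_differentiable_on_sum[OF \<open>open S\<close>] times_differentiable_on_bilinear[OF bounded_bilinear_scaleR \<open>open S\<close>])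
      fix b :: 'b
      show "times_differentiable_on k S (\<lambda>x. frechet_derivative F (at x) v \<bullet> b)"
        using F by (intro times_differentiable_on_bounded_linear_compose[OF bounded_linear_inner_left \<open>open S\<close>]) simp
      show "times_differentiable_on k S (\<lambda>x. frechet_derivative h (at (F x)) b)"
        using h by (intro Suc.IH[OF times_differentiable_on_SucD[OF F]]) simp
    qed
  qed
qed

lemma times_differentiable_on_subset:
  "times_differentiable_on k S f \<Longrightarrow> T \<subseteq> S \<Longrightarrow> times_differentiable_on k T f"
  by (induction k arbitrary: f) (auto intro: continuous_on_subset)

lemma smooth_on_subset: "smooth_on S f \<Longrightarrow> T \<subseteq> S \<Longrightarrow> smooth_on T f"
  using times_differentiable_on_subset[of _ S f T] unfolding smooth_on_def by simp

lemma smooth_on_const: "smooth_on S (\<lambda>x. c)"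
  unfolding smooth_on_def by (simp add: times_differentiable_on_const)

lemma smooth_on_bounded_linear_compose:
  "bounded_linear L \<Longrightarrow> open S \<Longrightarrow> smooth_on S f \<Longrightarrow> smooth_on S (\<lambda>x. L (f x))"
  unfolding smooth_on_def by (simp add: times_differentiable_on_bounded_linear_compose)

lemma smooth_on_add:
  "open S \<Longrightarrow> smooth_on S f \<Longrightarrow> smooth_on S g \<Longrightarrow> smooth_on S (\<lambda>x. f x + g x)"
  unfolding smooth_on_def by (simp add: times_differentiable_on_add)

lemma smooth_on_sum:
  "open S \<Longrightarrow> (\<And>i. i \<in> I \<Longrightarrow> smooth_on S (f i)) \<Longrightarrow> smooth_on S (\<lambda>x. \<Sum>i\<in>I. f i x)"
  unfolding smooth_on_def by (simp add: times_differentiable_on_sum)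

lemma smooth_on_bilinear:
  "bounded_bilinear p \<Longrightarrow> open S \<Longrightarrow> smooth_on S f \<Longrightarrow> smooth_on S g \<Longrightarrow> smooth_on S (\<lambda>x. p (f x) (g x))"
  unfolding smooth_on_def by (simp add: times_differentiable_on_bilinear)

lemmas smooth_on_mult = smooth_on_bilinear[OF bounded_bilinear_mult]

lemma smooth_on_compose:
  fixes F :: "'a::real_normed_vector \<Rightarrow> 'b::euclidean_space" and h :: "'b \<Rightarrow> 'c::real_normed_vector"
  shows "smooth_on T h \<Longrightarrow> smooth_on S F \<Longrightarrow> open S \<Longrightarrow> open T \<Longrightarrow> F ` S \<subseteq> T \<Longrightarrow> smooth_on S (\<lambda>x. h (F x))"
  unfolding smooth_on_def by (simp add: times_differentiable_on_compose[of S T F _ h])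

lemma smooth_on_imp_differentiable: "smooth_on S f \<Longrightarrow> x \<in> S \<Longrightarrow> f differentiable (at x)"
proof -
  assume "smooth_on S f" and x: "x \<in> S"
  then have "times_differentiable_on (Suc 0) S f" unfolding smooth_on_def by blast
  with x show ?thesis by simp
qed

lemma smooth_on_has_derivative:
  "smooth_on S f \<Longrightarrow> x \<in> S \<Longrightarrow> (f has_derivative frechet_derivative f (at x)) (at x)"
  by (simp add: frechet_derivative_works[THEN iffD1] smooth_on_imp_differentiable)

lemma smooth_on_imp_continuous_on: "smooth_on S f \<Longrightarrow> continuous_on S f"
  using times_differentiable_on.simps(1)[of S f] unfolding smooth_on_def by (rule iffD1) (rule spec)

lemma smooth_on_frechet_derivative:
  "smooth_on S f \<Longrightarrow> smooth_on S (\<lambda>x. frechet_derivative f (at x) v)"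
  unfolding smooth_on_def
proof
  fix k assume "\<forall>k. times_differentiable_on k S f"
  then have "times_differentiable_on (Suc k) S f" by (rule spec)
  then show "times_differentiable_on k S (\<lambda>x. frechet_derivative f (at x) v)" by simp
qed

lemma smooth_on_exp_linear:
  fixes L :: "'a::real_normed_vector \<Rightarrow> complex"
  assumes "bounded_linear L" "open S"
  shows "smooth_on S (\<lambda>x. exp (L x))"
proof -
  \<comment> \<open>The constant is generalised because differentiation in direction
    \<open>v\<close> keeps this form and replaces \<open>c\<close> by
    \<open>c * L v\<close>.\<close>
  have "times_differentiable_on k S (\<lambda>x. c * exp (L x))" for k c
  proof (induction k arbitrary: c)
    case 0
    show ?case using linear_continuous_on[OF assms(1)] by (simp add: continuous_on_mult_left continuous_on_exp)
  next
    case (Suc k)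
    show ?case
    proof (rule times_differentiable_on_SucI[OF \<open>open S\<close>, of _ "\<lambda>x v. (c * L v) * exp (L x)"])
      show "((\<lambda>x. c * exp (L x)) has_derivative (\<lambda>v. c * L v * exp (L x))) (at x)" for x
        using has_derivative_mult_right[OF has_derivative_compose[where g = exp,
              OF bounded_linear_imp_has_derivative[OF assms(1)] DERIV_exp[unfolded has_field_derivative_def]]]
        by (simp add: mult_ac)
    qed (rule Suc.IH)
  qed
  from this[of _ 1] show ?thesis unfolding smooth_on_def by simp
qed

text \<open>Both orders of differentiation are limits of the second difference quotient at \<open>x\<close>,
  by applying the mean value theorem twice.\<close>

lemma second_difference_mean_value:
  fixes f :: "'a::real_normed_vector \<Rightarrow> real"
  assumes "smooth_on S f" "0 < r"
    and S: "\<And>s t. \<bar>s\<bar> \<le> r \<Longrightarrow> \<bar>t\<bar> \<le> r \<Longrightarrow> x + s *\<^sub>R u + t *\<^sub>R v \<in> S"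
  shows "\<exists>s t. 0 < s \<and> s < r \<and> 0 < t \<and> t < r \<and>
    f (x + r *\<^sub>R u + r *\<^sub>R v) - f (x + r *\<^sub>R u) - f (x + r *\<^sub>R v) + f x
      = r * r * frechet_derivative (\<lambda>y. frechet_derivative f (at y) u) (at (x + s *\<^sub>R u + t *\<^sub>R v)) v"
proof -
  have line: "((\<lambda>s. k (y + s *\<^sub>R w)) has_real_derivative frechet_derivative k (at (y + s *\<^sub>R w)) w) (at s)"
    if "smooth_on S k" "y + s *\<^sub>R w \<in> S" for k :: "'a \<Rightarrow> real" and y s w
  proof -
    have "((\<lambda>s. k (y + s *\<^sub>R w)) has_derivative (\<lambda>h. frechet_derivative k (at (y + s *\<^sub>R w)) (h *\<^sub>R w))) (at s)"
      by (rule has_derivative_compose[where f = "\<lambda>s. y + s *\<^sub>R w" and g = k,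
            OF _ smooth_on_has_derivative[OF that]])
        (auto intro!: derivative_eq_intros)
    moreover have "linear (frechet_derivative k (at (y + s *\<^sub>R w)))"
      using smooth_on_has_derivative[OF that] has_derivative_linear by blast
    ultimately show ?thesis
      by (simp add: has_field_derivative_def linear_cmul mult_commute_abs)
  qed
  define G where "G s = f ((x + r *\<^sub>R v) + s *\<^sub>R u) - f (x + s *\<^sub>R u)" for s
  have "(G has_real_derivative (frechet_derivative f (at ((x + r *\<^sub>R v) + s *\<^sub>R u)) u
        - frechet_derivative f (at (x + s *\<^sub>R u)) u)) (at s)" if "0 \<le> s" "s \<le> r" for s
    unfolding G_def
  proof (intro DERIV_diff line[OF assms(1)])
    show "x + r *\<^sub>R v + s *\<^sub>R u \<in> S" using S[of s r] that by (simp add: algebra_simps)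
    show "x + s *\<^sub>R u \<in> S" using S[of s 0] that by simp
  qed
  from MVT2[OF \<open>0 < r\<close> this] obtain s where s: "0 < s" "s < r"
    and Gs: "G r - G 0 = (r - 0) * (frechet_derivative f (at ((x + r *\<^sub>R v) + s *\<^sub>R u)) u
        - frechet_derivative f (at (x + s *\<^sub>R u)) u)" by blast
  define k where "k y = frechet_derivative f (at y) u" for y
  have k: "smooth_on S k" unfolding k_def[abs_def] by (rule smooth_on_frechet_derivative[OF assms(1)])
  have "((\<lambda>t. k ((x + s *\<^sub>R u) + t *\<^sub>R v)) has_real_derivative
      frechet_derivative k (at ((x + s *\<^sub>R u) + t *\<^sub>R v)) v) (at t)" if "0 \<le> t" "t \<le> r" for t
    by (rule line[OF k]) (use S[of s t] that s in auto)
  from MVT2[OF \<open>0 < r\<close> this] obtain t where t: "0 < t" "t < r"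
    and kt: "k (x + s *\<^sub>R u + r *\<^sub>R v) - k (x + s *\<^sub>R u)
      = r * frechet_derivative k (at ((x + s *\<^sub>R u) + t *\<^sub>R v)) v" by auto
  have "f (x + r *\<^sub>R u + r *\<^sub>R v) - f (x + r *\<^sub>R u) - f (x + r *\<^sub>R v) + f x = G r - G 0"
    unfolding G_def by (simp add: algebra_simps)
  also have "\<dots> = r * (k (x + s *\<^sub>R u + r *\<^sub>R v) - k (x + s *\<^sub>R u))"
    unfolding Gs k_def by (simp add: algebra_simps)
  also have "\<dots> = r * r * frechet_derivative k (at ((x + s *\<^sub>R u) + t *\<^sub>R v)) v"
    unfolding kt by simp
  finally show ?thesis using s t unfolding k_def[abs_def] by blast
qed

lemma second_derivative_symmetric_real:
  fixes f :: "'a::real_normed_vector \<Rightarrow> real"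
  assumes f: "smooth_on S f" and "open S" "x \<in> S"
  shows "frechet_derivative (\<lambda>y. frechet_derivative f (at y) u) (at x) v
       = frechet_derivative (\<lambda>y. frechet_derivative f (at y) v) (at x) u"
proof (rule ccontr)
  define p where "p y = frechet_derivative (\<lambda>y. frechet_derivative f (at y) u) (at y) v" for y
  define q where "q y = frechet_derivative (\<lambda>y. frechet_derivative f (at y) v) (at y) u" for y
  assume "\<not> ?thesis"
  \<comment> \<open>Half of the gap: the mean value lemma finds two points near \<open>x\<close> at
    which \<open>p\<close> and \<open>q\<close> agree, and each of these values will be within
    \<open>?e\<close> of the value at \<open>x\<close>.\<close>
  then have e: "\<bar>p x - q x\<bar> / 2 > 0" (is "?e > 0") unfolding p_def q_def by simp
  have "smooth_on S p" "smooth_on S q" unfolding p_def[abs_def] q_def[abs_def]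
    by (intro smooth_on_frechet_derivative f)+
  then have c: "continuous (at x) p" "continuous (at x) q"
    using smooth_on_imp_continuous_on continuous_on_eq_continuous_at[OF \<open>open S\<close>] \<open>x \<in> S\<close> by blast+
  obtain d1 where d1: "d1 > 0" "\<And>y. dist y x < d1 \<Longrightarrow> dist (p y) (p x) < ?e"
    using c(1) e unfolding continuous_at_eps_delta by blast
  obtain d2 where d2: "d2 > 0" "\<And>y. dist y x < d2 \<Longrightarrow> dist (q y) (q x) < ?e"
    using c(2) e unfolding continuous_at_eps_delta by blast
  obtain d3 where d3: "d3 > 0" "ball x d3 \<subseteq> S" using \<open>open S\<close> \<open>x \<in> S\<close> open_contains_ball by blast
  define d where "d = min d1 (min d2 d3)"
  have d: "d > 0" using d1 d2 d3 unfolding d_def by auto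
  \<comment> \<open>This choice keeps the whole parallelogram spanned by \<open>r u\<close> and
    \<open>r v\<close> within distance \<open>d\<close> of \<open>x\<close>; the summand 1 covers
    the case that both vectors vanish.\<close>
  define r where "r = d / (2 * (norm u + norm v + 1))"
  have r: "r > 0" unfolding r_def using d by (intro divide_pos_pos) (auto simp: add_nonneg_pos)
  have near: "dist (x + s *\<^sub>R u + t *\<^sub>R v) x < d" if "\<bar>s\<bar> \<le> r" "\<bar>t\<bar> \<le> r" for s t
  proof -
    have "dist (x + s *\<^sub>R u + t *\<^sub>R v) x = norm (s *\<^sub>R u + t *\<^sub>R v)" by (simp add: dist_norm algebra_simps)
    also have "\<dots> \<le> \<bar>s\<bar> * norm u + \<bar>t\<bar> * norm v" by (metis norm_scaleR norm_triangle_ineq)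
    also have "\<dots> \<le> r * norm u + r * norm v" using that by (intro add_mono mult_right_mono) auto
    also have "\<dots> < r * (2 * (norm u + norm v + 1))" using r
      by (simp add: algebra_simps add_pos_nonneg add_nonneg_pos)
    also have "\<dots> = d" unfolding r_def
      by (metis add_nonneg_pos norm_ge_zero add_nonneg_nonneg less_irrefl nonzero_eq_divide_eq
          mult_pos_pos zero_less_numeral zero_less_one)
    finally show ?thesis .
  qed
  have S: "x + s *\<^sub>R u + t *\<^sub>R v \<in> S" if "\<bar>s\<bar> \<le> r" "\<bar>t\<bar> \<le> r" for s t
    using near[OF that] d3 by (auto simp: d_def dist_commute mem_ball subset_iff)
  have S': "x + s *\<^sub>R v + t *\<^sub>R u \<in> S" if "\<bar>s\<bar> \<le> r" "\<bar>t\<bar> \<le> r" for s t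
    using S[OF that(2,1)] by (simp add: algebra_simps)
  obtain s t where st: "0 < s" "s < r" "0 < t" "t < r"
    "f (x + r *\<^sub>R u + r *\<^sub>R v) - f (x + r *\<^sub>R u) - f (x + r *\<^sub>R v) + f x = r * r * p (x + s *\<^sub>R u + t *\<^sub>R v)"
    using second_difference_mean_value[OF f r S] unfolding p_def by blast
  obtain s' t' where st': "0 < s'" "s' < r" "0 < t'" "t' < r"
    "f (x + r *\<^sub>R v + r *\<^sub>R u) - f (x + r *\<^sub>R v) - f (x + r *\<^sub>R u) + f x = r * r * q (x + s' *\<^sub>R v + t' *\<^sub>R u)"
    using second_difference_mean_value[OF f r S'] unfolding q_def by blast
  have "r * r * p (x + s *\<^sub>R u + t *\<^sub>R v) = r * r * q (x + s' *\<^sub>R v + t' *\<^sub>R u)"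
    using st(5) st'(5) by (simp add: algebra_simps)
  then have eq: "p (x + s *\<^sub>R u + t *\<^sub>R v) = q (x + t' *\<^sub>R u + s' *\<^sub>R v)"
    using r by (simp add: algebra_simps)
  have "dist (p (x + s *\<^sub>R u + t *\<^sub>R v)) (p x) < ?e"
    using near[of s t] st by (intro d1) (auto simp: d_def)
  moreover have "dist (q (x + t' *\<^sub>R u + s' *\<^sub>R v)) (q x) < ?e"
    using near[of t' s'] st' by (intro d2) (auto simp: d_def)
  ultimately have "dist (p x) (q x) < \<bar>p x - q x\<bar>" using eq dist_triangle_half_r by metis
  then show False by (simp add: dist_real_def)
qed

lemma frechet_derivative_bounded_linear_compose:
  assumes "bounded_linear L" "f differentiable (at x)"
  shows "frechet_derivative (\<lambda>y. L (f y)) (at x) v = L (frechet_derivative f (at x) v)"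
  using frechet_derivative_at[OF bounded_linear.has_derivative[OF assms(1) frechet_derivative_works[THEN iffD1, OF assms(2)]]]
  by metis

lemma second_derivative_symmetric:
  fixes f :: "'a::real_normed_vector \<Rightarrow> 'b::real_inner"
  assumes f: "smooth_on S f" and S: "open S" "x \<in> S"
  shows "frechet_derivative (\<lambda>y. frechet_derivative f (at y) u) (at x) v
       = frechet_derivative (\<lambda>y. frechet_derivative f (at y) v) (at x) u"
proof -
  have "frechet_derivative (\<lambda>y. frechet_derivative f (at y) u) (at x) v \<bullet> b
     = frechet_derivative (\<lambda>y. frechet_derivative f (at y) v) (at x) u \<bullet> b" for b
  proof -
    note L = bounded_linear_inner_left[of b]
    have D: "frechet_derivative (\<lambda>y. frechet_derivative f (at y) u) (at x) v \<bullet> b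
      = frechet_derivative (\<lambda>y. frechet_derivative (\<lambda>y. f y \<bullet> b) (at y) u) (at x) v" for u v
    proof -
      have sm: "smooth_on S (\<lambda>y. frechet_derivative f (at y) u)"
        by (rule smooth_on_frechet_derivative[OF f])
      have "frechet_derivative (\<lambda>y. frechet_derivative f (at y) u) (at x) v \<bullet> b
        = frechet_derivative (\<lambda>y. frechet_derivative f (at y) u \<bullet> b) (at x) v"
        by (rule frechet_derivative_bounded_linear_compose[OF L smooth_on_imp_differentiable[OF sm S(2)], symmetric])
      also have "(\<lambda>y. frechet_derivative f (at y) u \<bullet> b) differentiable (at x)"
        using smooth_on_imp_differentiable[OF smooth_on_bounded_linear_compose[OF L S(1) sm] S(2)] .
      then have "frechet_derivative (\<lambda>y. frechet_derivative f (at y) u \<bullet> b) (at x)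
        = frechet_derivative (\<lambda>y. frechet_derivative (\<lambda>y. f y \<bullet> b) (at y) u) (at x)"
        by (rule frechet_derivative_transform_within_open[OF _ S])
          (simp add: frechet_derivative_bounded_linear_compose[OF L smooth_on_imp_differentiable[OF f]])
      finally show ?thesis .
    qed
    show ?thesis unfolding D
      by (rule second_derivative_symmetric_real[OF smooth_on_bounded_linear_compose[OF L S(1) f] S])
  qed
  then show ?thesis by (metis vector_eq_rdot)
qed

section \<open>Unique continuation for Cauchy--Riemann systems\<close>

text \<open>In the application \<open>H\<close> is a squared norm, \<open>Q\<close> an energy, and \<open>N = Q / H\<close> Almgren's frequency.
  The first differential inequality says that \<open>N + C t\<close> increases, so \<open>N\<close> is bounded to the left;
  by the second one \<open>log H\<close> cannot then drop to \<open>-\<infinity>\<close>.\<close>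

lemma frequency_zero_persists:
  fixes H Q H' Q' :: "real \<Rightarrow> real"
  assumes H: "\<And>t. t < c \<Longrightarrow> (H has_real_derivative H' t) (at t)"
    and Q: "\<And>t. t < c \<Longrightarrow> (Q has_real_derivative Q' t) (at t)"
    and nonneg: "\<And>t. t < c \<Longrightarrow> 0 \<le> H t"
    and freq: "\<And>t. t < c \<Longrightarrow> 0 < H t \<Longrightarrow> - C * H t \<le> Q' t - Q t / H t * H' t"
    and growth: "\<And>t. t < c \<Longrightarrow> H' t \<le> 2 * Q t + E * H t"
    and C: "0 \<le> C" and zero: "H t0 = 0" and t: "t0 \<le> t1" "t1 < c"
  shows "H t1 = 0"
proof (rule ccontr)
  assume "H t1 \<noteq> 0"
  then have pos1: "H t1 > 0" using nonneg[OF t(2)] by simp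
  have contH: "continuous_on {..<c} H"
    using H by (intro continuous_at_imp_continuous_on) (auto intro: DERIV_isCont)
  \<comment> \<open>The largest element \<open>s\<close> of \<open>Z\<close> is the last zero of
    \<open>H\<close> up to \<open>t1\<close>. Beyond it \<open>H\<close> is positive, so the
    frequency \<open>N\<close> is defined on the interval from \<open>s\<close> (excluded) to
    \<open>t1\<close>.\<close>
  define Z where "Z = {t0..t1} \<inter> H -` {0}"
  have "closed Z" unfolding Z_def
    by (rule continuous_closed_preimage[OF continuous_on_subset[OF contH]]) (use t in auto)
  then have "compact Z" unfolding Z_def by (metis Int_lower1 compact_Icc compact_Int_closed inf.absorb_iff2)
  moreover have "t0 \<in> Z" using zero t unfolding Z_def by simp
  ultimately obtain s where s: "s \<in> Z" and smax: "\<And>x. x \<in> Z \<Longrightarrow> x \<le> s"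
    using compact_attains_sup[of Z] by blast
  have st: "t0 \<le> s" "s < t1" "H s = 0" using s \<open>H t1 \<noteq> 0\<close> unfolding Z_def by (auto simp: less_le)
  have pos: "H x > 0" if "s < x" "x \<le> t1" for x
    using smax[of x] that st t nonneg[of x] unfolding Z_def by (force simp: less_le)
  define N where "N x = Q x / H x" for x
  define B where "B = N t1 + C * (t1 - s)"
  have NB: "N x \<le> B" if x: "s < x" "x \<le> t1" for x
  proof -
    have "(\<lambda>y. N y + C * y) x \<le> (\<lambda>y. N y + C * y) t1"
    proof (rule DERIV_nonneg_imp_nondecreasing[OF x(2)])
      fix y assume y: "x \<le> y" "y \<le> t1"
      then have yc: "y < c" and Hy: "H y > 0" using t x pos[of y] by auto
      have "((\<lambda>y. N y + C * y) has_real_derivative ((Q' y * H y - Q y * H' y) / (H y * H y) + C)) (at y)"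
        unfolding N_def using Hy by (auto intro!: derivative_eq_intros H Q yc)
      moreover have "(Q' y * H y - Q y * H' y) / (H y * H y) = (Q' y - Q y / H y * H' y) / H y"
        using Hy by (simp add: field_simps)
      moreover have "- C \<le> (Q' y - Q y / H y * H' y) / H y"
        using freq[OF yc Hy] Hy by (simp add: pos_le_divide_eq)
      ultimately show "\<exists>z. ((\<lambda>y. N y + C * y) has_real_derivative z) (at y) \<and> 0 \<le> z"
        by (intro exI[of _ "(Q' y * H y - Q y * H' y) / (H y * H y) + C"]) simp
    qed
    then have "N x \<le> N t1 + C * (t1 - x)" by (simp add: algebra_simps)
    also have "\<dots> \<le> B" unfolding B_def using C x by (simp add: mult_left_mono)
    finally show ?thesis .
  qed
  define D where "D = 2 * B + E"
  \<comment> \<open>The bound \<open>B\<close> on the frequency turns the growth inequality into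
    \<open>H' \<le> D * H\<close> to the right of \<open>s\<close>, so the weighted function cannot
    rise from its value 0 at \<open>s\<close>.\<close>
  have "H t1 * exp (- D * t1) \<le> H s * exp (- D * s)"
  proof (rule DERIV_nonpos_imp_decreasing_open[OF less_imp_le[OF st(2)]])
    fix x assume x: "s < x" "x < t1"
    then have xc: "x < c" and Hx: "H x > 0" using t pos[of x] by auto
    have "Q x = N x * H x" unfolding N_def using Hx by simp
    also have "\<dots> \<le> B * H x" using NB[of x] x Hx by (intro mult_right_mono) auto
    finally have "H' x \<le> D * H x" using growth[OF xc] unfolding D_def by (simp add: algebra_simps)
    then have "(H' x - D * H x) * exp (- D * x) \<le> 0" by (simp add: mult_nonpos_nonneg)
    moreover have "((\<lambda>x. H x * exp (- D * x)) has_real_derivative (H' x - D * H x) * exp (- D * x)) (at x)"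
      by (auto intro!: derivative_eq_intros H xc simp: algebra_simps)
    ultimately show "\<exists>y. ((\<lambda>x. H x * exp (- D * x)) has_real_derivative y) (at x) \<and> y \<le> 0" by blast
  next
    show "continuous_on {s..t1} (\<lambda>x. H x * exp (- D * x))"
      by (intro continuous_intros continuous_on_subset[OF contH]) (use t in auto)
  qed
  then show False using pos1 st(3) by (simp add: mult_le_0_iff)
qed

section \<open>Evolution equations on a periodic strip\<close>

lemma has_vector_derivative_fst_line:
  assumes "smooth_on S w" "(t, \<theta>) \<in> S"
  shows "((\<lambda>t. w (t, \<theta>)) has_vector_derivative frechet_derivative w (at (t, \<theta>)) (1, 0)) (at t)"
proof -
  note d = smooth_on_has_derivative[OF assms]
  have "((\<lambda>t. w (t, \<theta>)) has_derivative (\<lambda>h. frechet_derivative w (at (t, \<theta>)) (h, 0))) (at t)"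
    by (rule has_derivative_compose[where f = "\<lambda>t. (t, \<theta>)" and g = w, OF _ d])
      (intro has_derivative_Pair has_derivative_ident has_derivative_const)
  moreover have "(\<lambda>h. frechet_derivative w (at (t, \<theta>)) (h, 0)) = (\<lambda>h. h *\<^sub>R frechet_derivative w (at (t, \<theta>)) (1, 0))"
  proof
    fix h
    show "frechet_derivative w (at (t, \<theta>)) (h, 0) = h *\<^sub>R frechet_derivative w (at (t, \<theta>)) (1, 0)"
      using linear_cmul[OF has_derivative_linear[OF d], of h "(1, 0)"] by simp
  qed
  ultimately show ?thesis unfolding has_vector_derivative_def by simp
qed

lemma has_vector_derivative_snd_line:
  assumes "smooth_on S w" "(t, \<theta>) \<in> S"
  shows "((\<lambda>\<theta>. w (t, \<theta>)) has_vector_derivative frechet_derivative w (at (t, \<theta>)) (0, 1)) (at \<theta>)"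
proof -
  note d = smooth_on_has_derivative[OF assms]
  have "((\<lambda>\<theta>. w (t, \<theta>)) has_derivative (\<lambda>h. frechet_derivative w (at (t, \<theta>)) (0, h))) (at \<theta>)"
    by (rule has_derivative_compose[where f = "\<lambda>\<theta>. (t, \<theta>)" and g = w, OF _ d])
      (intro has_derivative_Pair has_derivative_ident has_derivative_const)
  moreover have "(\<lambda>h. frechet_derivative w (at (t, \<theta>)) (0, h)) = (\<lambda>h. h *\<^sub>R frechet_derivative w (at (t, \<theta>)) (0, 1))"
  proof
    fix h
    show "frechet_derivative w (at (t, \<theta>)) (0, h) = h *\<^sub>R frechet_derivative w (at (t, \<theta>)) (0, 1)"
      using linear_cmul[OF has_derivative_linear[OF d], of h "(0, 1)"] by simp
  qed
  ultimately show ?thesis unfolding has_vector_derivative_def by simp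
qed

lemma frechet_derivative_inner:
  assumes "f differentiable (at x)" "g differentiable (at x)"
  shows "frechet_derivative (\<lambda>y. f y \<bullet> g y) (at x) v
       = f x \<bullet> frechet_derivative g (at x) v + frechet_derivative f (at x) v \<bullet> g x"
  using frechet_derivative_at[OF has_derivative_inner[OF assms[THEN frechet_derivative_works[THEN iffD1]]]]
  by metis

text \<open>An evolution equation \<open>\<partial>\<^sub>t w = A w + f\<close> on the circle, with the symmetric operator
  \<open>A = - J \<partial>\<^sub>\<theta>\<close> and \<open>|f| \<le> K |w|\<close>.\<close>

lemma periodic_strip_unique_continuation:
  fixes w :: "real \<times> real \<Rightarrow> 'a::euclidean_space"
  assumes sm: "smooth_on ({..<c} \<times> UNIV) w"
    and J: "bounded_linear J" and skew: "\<And>u v. J u \<bullet> v = - (u \<bullet> J v)"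
    and per: "\<And>t. t < c \<Longrightarrow> w (t, 2 * pi) = w (t, 0)"
    and bound: "\<And>t \<theta>. t < c \<Longrightarrow> norm (frechet_derivative w (at (t, \<theta>)) (1, 0)
        + J (frechet_derivative w (at (t, \<theta>)) (0, 1))) \<le> K * norm (w (t, \<theta>))"
    and zero: "\<And>\<theta>. w (t0, \<theta>) = 0"
    and t: "t0 \<le> t1" "t1 < c" and \<theta>: "0 \<le> \<theta>" "\<theta> \<le> 2 * pi"
  shows "w (t1, \<theta>) = 0"
proof -
  define U where "U = {..<c} \<times> (UNIV :: real set)"
  have U: "open U" unfolding U_def by (intro open_Times) auto
  have mem [simp]: "(t, \<theta>) \<in> U \<longleftrightarrow> t < c" for t \<theta> unfolding U_def by simp
  note sm = sm[folded U_def]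
  define wt where "wt p = frechet_derivative w (at p) (1, 0)" for p
  define wr where "wr p = frechet_derivative w (at p) (0, 1)" for p
  define wtr where "wtr p = frechet_derivative wt (at p) (0, 1)" for p
  define a where "a p = - J (wr p)" for p
  define f where "f p = wt p + J (wr p)" for p
  have swt: "smooth_on U wt" unfolding wt_def[abs_def] by (rule smooth_on_frechet_derivative[OF sm])
  have swr: "smooth_on U wr" unfolding wr_def[abs_def] by (rule smooth_on_frechet_derivative[OF sm])
  have swtr: "smooth_on U wtr" unfolding wtr_def[abs_def] by (rule smooth_on_frechet_derivative[OF swt])
  have nJ: "bounded_linear (\<lambda>x. - J x)" by (rule bounded_linear_minus[OF J])
  have sa: "smooth_on U a" unfolding a_def[abs_def] by (rule smooth_on_bounded_linear_compose[OF nJ U swr])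
  have sf: "smooth_on U f" unfolding f_def[abs_def]
    by (intro smooth_on_add U swt smooth_on_bounded_linear_compose[OF J U] swr)
  have wt_eq: "wt p = a p + f p" for p unfolding a_def f_def by simp
  define I where "I \<phi> t = integral {0..2*pi} (\<lambda>\<theta>. \<phi> (t, \<theta>))" for \<phi> :: "real \<times> real \<Rightarrow> real" and t
  have cont_line: "continuous_on X (\<lambda>\<theta>. \<phi> (t, \<theta>))" if "smooth_on U \<phi>" "t < c" for \<phi> :: "real \<times> real \<Rightarrow> real" and t X
    by (rule continuous_on_compose2[OF smooth_on_imp_continuous_on[OF that(1)]])
      (use that in \<open>auto intro!: continuous_intros\<close>)
  have int: "(\<lambda>\<theta>. \<phi> (t, \<theta>)) integrable_on {0..2*pi}" if "smooth_on U \<phi>" "t < c" for \<phi> :: "real \<times> real \<Rightarrow> real" and t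
    by (intro integrable_continuous_real cont_line that)
  have dI: "((I \<phi>) has_real_derivative I (\<lambda>p. frechet_derivative \<phi> (at p) (1, 0)) t) (at t)"
    if \<phi>: "smooth_on U \<phi>" and t: "t < c" for \<phi> t
  proof -
    have "((\<lambda>t. integral (cbox 0 (2*pi)) (\<lambda>\<theta>. \<phi> (t, \<theta>))) has_vector_derivative
        integral (cbox 0 (2*pi)) (\<lambda>\<theta>. frechet_derivative \<phi> (at (t, \<theta>)) (1, 0))) (at t within {..<c})"
    proof (rule leibniz_rule_vector_derivative)
      show "((\<lambda>x. \<phi> (x, \<theta>)) has_vector_derivative frechet_derivative \<phi> (at (x, \<theta>)) (1, 0)) (at x within {..<c})"
        if "x \<in> {..<c}" for x \<theta>
        using has_vector_derivative_fst_line[OF \<phi>, of x \<theta>] that by (auto intro: has_vector_derivative_at_within)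
      show "(\<lambda>\<theta>. \<phi> (x, \<theta>)) integrable_on cbox 0 (2 * pi)" if "x \<in> {..<c}" for x
        using int[OF \<phi>, of x] that by simp
      show "continuous_on ({..<c} \<times> cbox 0 (2 * pi)) (\<lambda>(x, \<theta>). frechet_derivative \<phi> (at (x, \<theta>)) (1, 0))"
        using continuous_on_subset[OF smooth_on_imp_continuous_on[OF smooth_on_frechet_derivative[OF \<phi>, of "(1, 0)"]],
            of "{..<c} \<times> cbox 0 (2 * pi)"]
        by (auto simp: case_prod_beta U_def)
    qed (use t in auto)
    then show ?thesis using t
      by (simp add: I_def[abs_def] has_real_derivative_iff_has_vector_derivative at_within_open[of t "{..<c}"])
  qed
  have sin: "smooth_on U (\<lambda>p. x p \<bullet> y p)" if "smooth_on U x" "smooth_on U y" for x y :: "real \<times> real \<Rightarrow> 'a"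
    by (rule smooth_on_bilinear[OF bounded_bilinear_inner U that])
  have diff: "x differentiable (at p)" if "smooth_on U x" "p \<in> U" for x :: "real \<times> real \<Rightarrow> 'a" and p
    using that by (rule smooth_on_imp_differentiable)
  \<comment> \<open>\<open>H\<close> is the squared norm of \<open>w\<close> on the circle at time
    \<open>t\<close>; since \<open>a\<close> is the symmetric operator applied to \<open>w\<close>,
    \<open>Q\<close> is the quadratic form of that operator.\<close>
  define H where "H = I (\<lambda>p. w p \<bullet> w p)"
  define Q where "Q = I (\<lambda>p. a p \<bullet> w p)"
  have Icong: "I \<phi> t = I \<psi> t" if "\<And>\<theta>. \<phi> (t, \<theta>) = \<psi> (t, \<theta>)" for \<phi> \<psi> t
    unfolding I_def using that by simp
  have Iadd: "I (\<lambda>p. \<phi> p + \<psi> p) t = I \<phi> t + I \<psi> t" if "smooth_on U \<phi>" "smooth_on U \<psi>" "t < c" for \<phi> \<psi> t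
    unfolding I_def using that by (intro integral_add int)
  have Icmul: "I (\<lambda>p. k * \<phi> p) t = k * I \<phi> t" for k \<phi> t
    unfolding I_def by simp
  have Ile: "I \<phi> t \<le> I \<psi> t" if "smooth_on U \<phi>" "smooth_on U \<psi>" "t < c" "\<And>\<theta>. \<phi> (t, \<theta>) \<le> \<psi> (t, \<theta>)" for \<phi> \<psi> t
    unfolding I_def using that by (intro integral_le int) auto
  note sww = sin[OF sm sm] and saw = sin[OF sa sm] and sfw = sin[OF sf sm] and saa = sin[OF sa sa] and saf = sin[OF sa sf]
  note sff = sin[OF sf sf]
  have H': "(H has_real_derivative (2 * Q t + 2 * I (\<lambda>p. f p \<bullet> w p) t)) (at t)" if t: "t < c" for t
  proof -
    have "I (\<lambda>p. frechet_derivative (\<lambda>p. w p \<bullet> w p) (at p) (1, 0)) t = I (\<lambda>p. 2 * (a p \<bullet> w p) + 2 * (f p \<bullet> w p)) t"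
      by (rule Icong, subst frechet_derivative_inner)
        (use t in \<open>auto simp: wt_def[symmetric] wt_eq inner_add inner_commute intro!: diff sm\<close>)
    also have "\<dots> = 2 * Q t + 2 * I (\<lambda>p. f p \<bullet> w p) t"
      unfolding Q_def using t by (subst Iadd) (auto intro!: smooth_on_mult smooth_on_const U saw sfw simp: Icmul)
    finally show ?thesis using dI[OF sww t] unfolding H_def by simp
  qed
  \<comment> \<open>The boundary terms of the integration by parts below contain \<open>wt\<close>;
    its periodicity is that of \<open>w\<close>, differentiated in \<open>t\<close>.\<close>
  have wtper: "wt (t, 2 * pi) = wt (t, 0)" if t: "t < c" for t
  proof -
    have "((\<lambda>t. w (t, 2 * pi)) has_vector_derivative wt (t, 2 * pi)) (at t)"
      unfolding wt_def by (rule has_vector_derivative_fst_line[OF sm]) (use t in simp)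
    then have "((\<lambda>t. w (t, 0)) has_vector_derivative wt (t, 2 * pi)) (at t)"
      by (rule has_vector_derivative_transform_within_open[where S = "{..<c}"]) (use t per in auto)
    moreover have "((\<lambda>t. w (t, 0)) has_vector_derivative wt (t, 0)) (at t)"
      unfolding wt_def by (rule has_vector_derivative_fst_line[OF sm]) (use t in simp)
    ultimately show ?thesis by (rule vector_derivative_unique_at)
  qed
  \<comment> \<open>For a symmetric operator the derivative of its quadratic form is twice the
    pairing of \<open>a\<close> with \<open>wt = a + f\<close>. The symmetry is integration by parts
    in \<theta>, recorded as fact \<open>1\<close>, together with the skewness of \<open>J\<close>
    and the commutation of the mixed partial derivatives of \<open>w\<close>.\<close>
  have Q': "(Q has_real_derivative (2 * I (\<lambda>p. a p \<bullet> a p) t + 2 * I (\<lambda>p. a p \<bullet> f p) t)) (at t)" if t: "t < c" for t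
  proof -
    have swJ: "smooth_on U (\<lambda>p. J (w p))" by (rule smooth_on_bounded_linear_compose[OF J U sm])
    have "integral {0..2*pi} (\<lambda>\<theta>. frechet_derivative (\<lambda>p. wt p \<bullet> J (w p)) (at (t, \<theta>)) (0, 1))
        = wt (t, 2*pi) \<bullet> J (w (t, 2*pi)) - wt (t, 0) \<bullet> J (w (t, 0))"
      by (intro integral_unique fundamental_theorem_of_calculus)
        (auto intro!: has_vector_derivative_at_within has_vector_derivative_snd_line[OF sin[OF swt swJ]] t)
    then have "I (\<lambda>p. frechet_derivative (\<lambda>p. wt p \<bullet> J (w p)) (at p) (0, 1)) t = 0"
      unfolding I_def by (simp add: per[OF t] wtper[OF t])
    also have "I (\<lambda>p. frechet_derivative (\<lambda>p. wt p \<bullet> J (w p)) (at p) (0, 1)) t = I (\<lambda>p. wtr p \<bullet> J (w p) + (-1) * (wt p \<bullet> a p)) t"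
      by (rule Icong, subst frechet_derivative_inner)
        (use t in \<open>auto simp: wtr_def wr_def a_def frechet_derivative_bounded_linear_compose[OF J diff[OF sm]] intro!: diff swt swJ\<close>)
    also have "\<dots> = I (\<lambda>p. wtr p \<bullet> J (w p)) t + (-1) * I (\<lambda>p. wt p \<bullet> a p) t"
      unfolding Iadd[OF sin[OF swtr swJ] smooth_on_mult[OF U smooth_on_const[of U "-1"] sin[OF swt sa]] t] Icmul ..
    finally have 1: "I (\<lambda>p. wtr p \<bullet> J (w p)) t = I (\<lambda>p. wt p \<bullet> a p) t" by simp
    have da: "frechet_derivative a (at p) (1, 0) = - J (wtr p)" if p: "p \<in> U" for p
    proof -
      have "frechet_derivative a (at p) (1, 0) = - J (frechet_derivative wr (at p) (1, 0))"
        unfolding a_def[abs_def] by (rule frechet_derivative_bounded_linear_compose[OF nJ diff[OF swr p]])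
      also have "frechet_derivative wr (at p) (1, 0) = wtr p"
        unfolding wtr_def wr_def[abs_def] wt_def[abs_def] by (rule second_derivative_symmetric[OF sm U p])
      finally show ?thesis .
    qed
    have J_swap: "w p \<bullet> J (wtr p) = - (wtr p \<bullet> J (w p))" for p by (metis skew inner_commute)
    have "I (\<lambda>p. frechet_derivative (\<lambda>p. a p \<bullet> w p) (at p) (1, 0)) t = I (\<lambda>p. wtr p \<bullet> J (w p) + wt p \<bullet> a p) t"
      by (rule Icong, subst frechet_derivative_inner)
        (use t in \<open>auto simp: wt_def[symmetric] da J_swap inner_commute intro!: diff sm sa\<close>)
    also have "\<dots> = I (\<lambda>p. wtr p \<bullet> J (w p)) t + I (\<lambda>p. wt p \<bullet> a p) t"
      using t by (intro Iadd sin swtr swJ swt sa)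
    also have "\<dots> = 2 * I (\<lambda>p. a p \<bullet> a p + a p \<bullet> f p) t"
      unfolding 1 wt_eq by (simp add: inner_add inner_commute)
    also have "\<dots> = 2 * I (\<lambda>p. a p \<bullet> a p) t + 2 * I (\<lambda>p. a p \<bullet> f p) t"
      using t by (simp add: Iadd[OF saa saf])
    finally show ?thesis using dI[OF saw t] unfolding Q_def by simp
  qed
  have fle: "norm (f (t, \<theta>)) \<le> K * norm (w (t, \<theta>))" if "t < c" for t \<theta>
    using bound[OF that] unfolding f_def wt_def wr_def .
  have Hnn: "0 \<le> H t" if "t < c" for t
    unfolding H_def I_def by (rule integral_nonneg[OF int[OF sww that]]) simp
  have fw: "I (\<lambda>p. f p \<bullet> w p) t \<le> K * H t" if t: "t < c" for t
    unfolding H_def Icmul[symmetric]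
  proof (rule Ile[OF sfw _ t])
    show "f (t, \<theta>) \<bullet> w (t, \<theta>) \<le> K * (w (t, \<theta>) \<bullet> w (t, \<theta>))" for \<theta>
    proof -
      have "f (t, \<theta>) \<bullet> w (t, \<theta>) \<le> norm (f (t, \<theta>)) * norm (w (t, \<theta>))" by (rule norm_cauchy_schwarz)
      also have "\<dots> \<le> (K * norm (w (t, \<theta>))) * norm (w (t, \<theta>))" using fle[OF t] by (rule mult_right_mono) simp
      finally show ?thesis by (simp add: dot_square_norm power2_eq_square)
    qed
    show "smooth_on U (\<lambda>p. K * (w p \<bullet> w p))" by (intro smooth_on_mult smooth_on_const U sww)
  qed
  have "H t1 = 0"
  proof (rule frequency_zero_persists[OF H' Q' Hnn _ _ _ _ t])
    show "2 * Q t + 2 * I (\<lambda>p. f p \<bullet> w p) t \<le> 2 * Q t + (2 * K) * H t" if "t < c" for t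
      using fw[OF that] by simp
    show "0 \<le> K\<^sup>2 / 2" by simp
    show "H t0 = 0" unfolding H_def I_def by (simp add: zero)
    fix t assume t: "t < c" and Hpos: "H t > 0"
    \<comment> \<open>With \<open>e = a - N w\<close>, completing the square bounds
      \<open>e \<bullet> e + e \<bullet> f\<close> below by minus a quarter of
      \<open>f \<bullet> f\<close>, hence by \<open>- (K\<^sup>2 / 4) * (w \<bullet> w)\<close>.
      Because \<open>N * H t = Q t\<close>, the integral of
      \<open>e \<bullet> e + e \<bullet> f\<close> is exactly half of the derivative of
      \<open>Q\<close> minus \<open>N\<close> times the derivative of \<open>H\<close>. Doubling
      yields the constant \<open>K\<^sup>2 / 2\<close>.\<close>
    define N where "N = Q t / H t"
    have NH: "N * H t = Q t" unfolding N_def using Hpos by simp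
    have s: "smooth_on U (\<lambda>p. k * \<phi> p)" if "smooth_on U \<phi>" for k and \<phi> :: "real \<times> real \<Rightarrow> real"
      by (intro smooth_on_mult smooth_on_const U that)
    have "I (\<lambda>p. - (K\<^sup>2 / 4) * (w p \<bullet> w p)) t
      \<le> I (\<lambda>p. a p \<bullet> a p + (a p \<bullet> f p + ((- N) * (f p \<bullet> w p) + ((- 2 * N) * (a p \<bullet> w p) + N\<^sup>2 * (w p \<bullet> w p))))) t"
    proof (rule Ile[OF _ _ t])
      fix \<theta> :: real
      let ?p = "(t, \<theta>)"
      define e where "e = a ?p - N *\<^sub>R w ?p"
      have "(norm (f ?p))\<^sup>2 \<le> (K * norm (w ?p))\<^sup>2" by (rule power_mono[OF fle[OF t]]) simp
      then have "f ?p \<bullet> f ?p \<le> K\<^sup>2 * (w ?p \<bullet> w ?p)" by (simp add: dot_square_norm power_mult_distrib)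
      moreover have "0 \<le> (e + (1/2) *\<^sub>R f ?p) \<bullet> (e + (1/2) *\<^sub>R f ?p)" by simp
      then have "- (1/4) * (f ?p \<bullet> f ?p) \<le> e \<bullet> e + e \<bullet> f ?p"
        by (simp add: inner_add inner_commute)
      moreover have "e \<bullet> e + e \<bullet> f ?p = a ?p \<bullet> a ?p + (a ?p \<bullet> f ?p + ((- N) * (f ?p \<bullet> w ?p) + ((- 2 * N) * (a ?p \<bullet> w ?p) + N\<^sup>2 * (w ?p \<bullet> w ?p))))"
        unfolding e_def by (simp add: inner_diff inner_commute power2_eq_square algebra_simps)
      ultimately show "- (K\<^sup>2 / 4) * (w ?p \<bullet> w ?p) \<le> a ?p \<bullet> a ?p + (a ?p \<bullet> f ?p + ((- N) * (f ?p \<bullet> w ?p) + ((- 2 * N) * (a ?p \<bullet> w ?p) + N\<^sup>2 * (w ?p \<bullet> w ?p))))"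
        by simp
    qed (intro smooth_on_add U s saa saf sfw saw sww)+
    also have "\<dots> = I (\<lambda>p. a p \<bullet> a p) t + (I (\<lambda>p. a p \<bullet> f p) t + ((- N) * I (\<lambda>p. f p \<bullet> w p) t + ((- 2 * N) * Q t + N\<^sup>2 * H t)))"
      unfolding Q_def H_def Icmul[symmetric]
      by (subst Iadd, (intro smooth_on_add U s saa saf sfw saw sww t)+)+ (rule refl)
    finally have "- (K\<^sup>2 / 4) * H t \<le> I (\<lambda>p. a p \<bullet> a p) t + I (\<lambda>p. a p \<bullet> f p) t - N * I (\<lambda>p. f p \<bullet> w p) t - N * Q t"
      unfolding Icmul H_def[symmetric] by (simp add: NH power2_eq_square mult.assoc)
    then show "- (K\<^sup>2 / 2) * H t \<le> 2 * I (\<lambda>p. a p \<bullet> a p) t + 2 * I (\<lambda>p. a p \<bullet> f p) t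
        - Q t / H t * (2 * Q t + 2 * I (\<lambda>p. f p \<bullet> w p) t)"
      unfolding N_def[symmetric] by (simp add: algebra_simps)
  qed
  then have "\<forall>\<theta>\<in>{0..2*pi}. w (t1, \<theta>) \<bullet> w (t1, \<theta>) = 0"
    unfolding H_def I_def using integral_eq_0_iff[OF cont_line[OF sww t(2), of "{0..2*pi}"]] by simp
  then show ?thesis using \<theta> by simp
qed

section \<open>Cauchy--Riemann inequalities on complex lines\<close>

lemma vec_scale_bounded_linear: "bounded_linear (\<lambda>v. s *s (v :: complex^'n::finite))"
  by (simp add: linear_conv_bounded_linear[symmetric] linear_iff vec_eq_iff algebra_simps)

lemma vec_scale_bounded_linear_left: "bounded_linear (\<lambda>s. s *s (v :: complex^'n::finite))"
  by (simp add: linear_conv_bounded_linear[symmetric] linear_iff vec_eq_iff algebra_simps)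

lemma norm_vec_scale: "norm (s *s (v :: complex^'n::finite)) = cmod s * norm v"
  by (simp add: norm_vec_def L2_set_def norm_mult power_mult_distrib sum_distrib_left[symmetric]
      real_sqrt_mult)

lemma inner_vec_scale_imaginary:
  fixes u v :: "complex^'n::finite"
  assumes "Re s = 0"
  shows "(s *s u) \<bullet> v = - (u \<bullet> (s *s v))"
  using assms by (simp add: inner_vec_def inner_complex_def sum_negf[symmetric] algebra_simps)

text \<open>For \<open>s = \<plusminus>\<i>\<close> the left-hand side of the bound is an (anti-)Cauchy--Riemann operator. On the complex
  line through \<open>z\<^sub>0\<close> and \<open>z\<^sub>1\<close>, written in logarithmic polar coordinates, it takes the form
  \<open>\<partial>\<^sub>t + J \<partial>\<^sub>\<theta>\<close>.\<close>

lemma cauchy_riemann_unique_continuation: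
  fixes u :: "complex^'m::finite \<Rightarrow> complex^'n::finite"
  assumes u: "smooth_on (ball z0 R) u" and s: "Re s = 0"
    and bound: "\<And>z b. z \<in> ball z0 R \<Longrightarrow> norm (frechet_derivative u (at z) b
        + s *s frechet_derivative u (at z) (\<i> *s b)) \<le> K * norm b * norm (u z)"
    and r: "0 < r" and zero: "\<And>z. z \<in> ball z0 r \<Longrightarrow> u z = 0"
    and z1: "z1 \<in> ball z0 R"
  shows "u z1 = 0"
proof (cases "z1 \<in> ball z0 r")
  case True
  then show ?thesis by (rule zero)
next
  case False
  define a where "a = z1 - z0"
  have a: "0 < norm a" "norm a < R" using False r z1 unfolding a_def
    by (auto simp: dist_norm norm_minus_commute)
  have R: "R > 0" using a by linarith
  \<comment> \<open>In the coordinates \<open>\<psi>\<close> the radius is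
    \<open>exp t * norm a\<close>, so \<open>t < c\<close> describes the ball of radius
    \<open>R\<close>. The point \<open>z1\<close> sits at \<open>(0, 0)\<close>, and
    \<open>c\<close> is positive because \<open>z1\<close> lies inside that ball.\<close>
  define c where "c = ln (R / norm a)"
  have c: "0 < c" unfolding c_def using a by (intro ln_gt_zero) simp
  have eR: "exp t * norm a < R" if "t < c" for t
  proof -
    have "exp t < exp c" using that by simp
    also have "exp c = R / norm a" unfolding c_def using a R by simp
    finally show ?thesis using a by (simp add: pos_less_divide_eq)
  qed
  define L where "L p = Complex (fst p) (snd p)" for p
  have L: "bounded_linear L"
    unfolding L_def by (simp add: linear_conv_bounded_linear[symmetric] linear_iff complex_eq_iff)
  define \<psi> where "\<psi> p = z0 + exp (L p) *s a" for p
  define U where "U = {..<c} \<times> (UNIV :: real set)"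
  have U: "open U" unfolding U_def by (intro open_Times) auto
  have nexp: "Re (L p) = fst p" for p unfolding L_def by simp
  have \<psi>s: "smooth_on U \<psi>" unfolding \<psi>_def
    by (intro smooth_on_add U smooth_on_const smooth_on_bounded_linear_compose[OF vec_scale_bounded_linear_left U]
        smooth_on_exp_linear L)
  have \<psi>R: "\<psi> p \<in> ball z0 R" if "p \<in> U" for p
    using eR[of "fst p"] that unfolding \<psi>_def U_def by (auto simp: dist_norm norm_vec_scale nexp)
  define w where "w p = u (\<psi> p)" for p
  have ws: "smooth_on U w" unfolding w_def
    by (rule smooth_on_compose[OF u \<psi>s U open_ball]) (use \<psi>R in auto)
  have dw: "frechet_derivative w (at p) v = frechet_derivative u (at (\<psi> p)) ((exp (L p) * L v) *s a)"
    if p: "p \<in> U" for p v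
  proof -
    have "((\<lambda>p. exp (L p)) has_derivative (\<lambda>v. exp (L p) * L v)) (at p)"
      using has_derivative_compose[where g = exp, OF bounded_linear_imp_has_derivative[OF L]
          DERIV_exp[unfolded has_field_derivative_def]] .
    then have "(\<psi> has_derivative (\<lambda>v. (exp (L p) * L v) *s a)) (at p)"
      unfolding \<psi>_def[abs_def]
      using has_derivative_add[OF has_derivative_const bounded_linear.has_derivative[OF vec_scale_bounded_linear_left]]
      by fastforce
    from has_derivative_compose[where g = u, OF this smooth_on_has_derivative[OF u \<psi>R[OF p]]]
    show ?thesis unfolding w_def[abs_def] using frechet_derivative_at by metis
  qed
  \<comment> \<open>The subtracted 1 places the circle at time \<open>t0\<close> strictly inside the
    ball where \<open>u\<close> vanishes; the minimum with 0 ensures that \<open>t0\<close> does not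
    come after the time 0 of \<open>z1\<close>.\<close>
  define t0 where "t0 = min 0 (ln (r / norm a) - 1)"
  have t0: "exp t0 * norm a < r"
  proof -
    have "exp t0 < exp (ln (r / norm a))" unfolding t0_def by simp
    also have "\<dots> = r / norm a" using a r by simp
    finally show ?thesis using a by (simp add: pos_less_divide_eq)
  qed
  have "w (0, 0) = 0"
  proof (rule periodic_strip_unique_continuation[OF ws[unfolded U_def] vec_scale_bounded_linear[of s] inner_vec_scale_imaginary[OF s]])
    show "w (t, 2 * pi) = w (t, 0)" for t
      by (simp add: w_def \<psi>_def L_def exp_eq_polar cis.ctr complex_eq_iff)
    show "w (t0, \<theta>) = 0" for \<theta>
      unfolding w_def by (rule zero) (use t0 in \<open>simp add: \<psi>_def dist_norm norm_vec_scale nexp\<close>)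
    show "norm (frechet_derivative w (at (t, \<theta>)) (1, 0) + s *s frechet_derivative w (at (t, \<theta>)) (0, 1))
        \<le> \<bar>K\<bar> * R * norm (w (t, \<theta>))" if t: "t < c" for t \<theta>
    proof -
      let ?p = "(t, \<theta>)" and ?b = "exp (L (t, \<theta>)) *s a"
      have p: "?p \<in> U" using t unfolding U_def by simp
      have L10: "L (1, 0) = 1" "L (0, 1) = \<i>" unfolding L_def by (simp_all add: complex_eq_iff)
      \<comment> \<open>Moving in \<theta> is moving in the direction \<open>\<i> *s ?b\<close> when
        moving in \<open>t\<close> is moving in the direction \<open>?b\<close>. With multiplication
        by \<open>s\<close> as \<open>J\<close>, which is skew since \<open>Re s = 0\<close>, the
        evolution operator is therefore the Cauchy--Riemann operator in direction \<open>?b\<close>,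
        and \<open>norm ?b < R\<close> accounts for the factor \<open>R\<close>.\<close>
      have "frechet_derivative w (at ?p) (1, 0) + s *s frechet_derivative w (at ?p) (0, 1)
        = frechet_derivative u (at (\<psi> ?p)) ?b + s *s frechet_derivative u (at (\<psi> ?p)) (\<i> *s ?b)"
        unfolding dw[OF p] L10 by (simp add: vector_smult_assoc mult.commute)
      also have "norm \<dots> \<le> K * norm ?b * norm (u (\<psi> ?p))" by (rule bound[OF \<psi>R[OF p]])
      also have "\<dots> \<le> (\<bar>K\<bar> * R) * norm (u (\<psi> ?p))"
        using eR[OF t] by (intro mult_right_mono mult_mono) (auto simp: norm_vec_scale nexp)
      finally show ?thesis unfolding w_def .
    qed
  qed (use c in \<open>auto simp: t0_def\<close>)
  then show ?thesis by (simp add: w_def \<psi>_def L_def a_def zero_complex.code[symmetric])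
qed

section \<open>Wirtinger calculus and the curvature identity\<close>

text \<open>A parameter covers both Wirtinger derivatives at once: conjugating the function
  conjugates \<open>s\<close>, and the arguments for \<partial> f and \<partial>-bar f become a
  single one.\<close>

definition wirtinger :: "complex \<Rightarrow> 'm::finite \<Rightarrow> (complex^'m \<Rightarrow> complex) \<Rightarrow> complex^'m \<Rightarrow> complex" where
  "wirtinger s \<alpha> \<phi> z = (frechet_derivative \<phi> (at z) (axis \<alpha> 1)
                   + s * frechet_derivative \<phi> (at z) (axis \<alpha> \<i>)) / 2"

lemma dz_eq_wirtinger: "dz \<alpha> \<phi> = wirtinger (- \<i>) \<alpha> \<phi>"
  and dzbar_eq_wirtinger: "dzbar \<alpha> \<phi> = wirtinger \<i> \<alpha> \<phi>"
  by (auto simp: dz_def dzbar_def wirtinger_def)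

lemma wirtinger_eqI:
  "(\<phi> has_derivative D) (at z) \<Longrightarrow> wirtinger s \<alpha> \<phi> z = (D (axis \<alpha> 1) + s * D (axis \<alpha> \<i>)) / 2"
  unfolding wirtinger_def using frechet_derivative_at by metis

lemma smooth_on_wirtinger:
  assumes "open S" "smooth_on S \<phi>"
  shows "smooth_on S (wirtinger s \<alpha> \<phi>)"
proof -
  have "smooth_on S (\<lambda>z. (1/2) * (frechet_derivative \<phi> (at z) (axis \<alpha> 1)
      + s * frechet_derivative \<phi> (at z) (axis \<alpha> \<i>)))"
    by (intro smooth_on_mult smooth_on_const smooth_on_add assms(1) smooth_on_frechet_derivative assms(2))
  then show ?thesis by (simp add: wirtinger_def[abs_def])
qed

lemma wirtinger_commute:
  assumes "open S" "smooth_on S \<phi>" "z \<in> S"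
  shows "wirtinger s \<alpha> (wirtinger t \<beta> \<phi>) z = wirtinger t \<beta> (wirtinger s \<alpha> \<phi>) z"
proof -
  define D2 where "D2 u = frechet_derivative (\<lambda>y. frechet_derivative \<phi> (at y) u) (at z)" for u
  have D2: "((\<lambda>y. frechet_derivative \<phi> (at y) u) has_derivative D2 u) (at z)" for u
    unfolding D2_def by (rule smooth_on_has_derivative[OF smooth_on_frechet_derivative[OF assms(2)] assms(3)])
  have W: "(wirtinger t \<beta> \<phi> has_derivative (\<lambda>v. (D2 (axis \<beta> 1) v + t * D2 (axis \<beta> \<i>) v) / 2)) (at z)" for t \<beta>
    unfolding wirtinger_def[abs_def]
    by (intro bounded_linear.has_derivative[OF bounded_linear_divide] has_derivative_add
        has_derivative_mult_right D2)
  have sym: "D2 u v = D2 v u" for u v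
    unfolding D2_def by (rule second_derivative_symmetric[OF assms(2,1,3)])
  show ?thesis
    unfolding wirtinger_eqI[OF W]
    by (simp add: sym[of "axis \<alpha> 1"] sym[of "axis \<alpha> \<i>"] field_simps)
qed

lemma wirtinger_cong:
  assumes "open S" "z \<in> S" "\<phi> differentiable (at z)" "\<And>y. y \<in> S \<Longrightarrow> \<phi> y = \<psi> y"
  shows "wirtinger s \<alpha> \<phi> z = wirtinger s \<alpha> \<psi> z"
  unfolding wirtinger_def using frechet_derivative_transform_within_open[OF assms(3,1,2)] assms(4) by metis

lemma wirtinger_mult:
  assumes "\<phi> differentiable (at z)" "\<psi> differentiable (at z)"
  shows "wirtinger s \<alpha> (\<lambda>y. \<phi> y * \<psi> y) z = wirtinger s \<alpha> \<phi> z * \<psi> z + \<phi> z * wirtinger s \<alpha> \<psi> z"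
  unfolding wirtinger_eqI[OF has_derivative_mult[OF assms[THEN frechet_derivative_works[THEN iffD1]]]]
  by (simp add: wirtinger_def field_simps)

lemma wirtinger_sum:
  assumes "\<And>i. i \<in> I \<Longrightarrow> \<phi> i differentiable (at z)"
  shows "wirtinger s \<alpha> (\<lambda>y. \<Sum>i\<in>I. \<phi> i y) z = (\<Sum>i\<in>I. wirtinger s \<alpha> (\<phi> i) z)"
proof -
  have "((\<lambda>y. \<Sum>i\<in>I. \<phi> i y) has_derivative (\<lambda>v. \<Sum>i\<in>I. frechet_derivative (\<phi> i) (at z) v)) (at z)"
    by (rule has_derivative_sum) (use assms in \<open>auto simp: frechet_derivative_works[symmetric]\<close>)
  from wirtinger_eqI[OF this] show ?thesis
    by (simp add: wirtinger_def sum_distrib_left sum.distrib add_divide_distrib sum_divide_distrib)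
qed

lemma wirtinger_cnj:
  assumes "\<phi> differentiable (at z)"
  shows "wirtinger s \<alpha> (\<lambda>y. cnj (\<phi> y)) z = cnj (wirtinger (cnj s) \<alpha> \<phi> z)"
  unfolding wirtinger_eqI[OF has_derivative_cnj[OF assms[THEN frechet_derivative_works[THEN iffD1]]]]
  by (simp add: wirtinger_def)

lemma vec_real_decomposition:
  fixes v :: "complex^'m::finite"
  shows "v = (\<Sum>\<alpha>\<in>UNIV. Re (v $ \<alpha>) *\<^sub>R axis \<alpha> 1 + Im (v $ \<alpha>) *\<^sub>R axis \<alpha> \<i>)"
proof (rule vec_eq_iff[THEN iffD2], intro allI)
  fix i
  have e: "(Re (v $ \<alpha>) *\<^sub>R axis \<alpha> 1 + Im (v $ \<alpha>) *\<^sub>R axis \<alpha> \<i>) $ i = (if \<alpha> = i then v $ \<alpha> else 0)" for \<alpha>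
    by (cases "\<alpha> = i") (simp_all add: axis_def complex_eq_iff)
  show "v $ i = (\<Sum>\<alpha>\<in>UNIV. Re (v $ \<alpha>) *\<^sub>R axis \<alpha> 1 + Im (v $ \<alpha>) *\<^sub>R axis \<alpha> \<i>) $ i"
    unfolding sum_component e by simp
qed

lemma derivative_wirtinger:
  fixes \<phi> :: "complex^'m::finite \<Rightarrow> complex"
  assumes "(\<phi> has_derivative D) (at z)"
  shows "D v = (\<Sum>\<alpha>\<in>UNIV. dz \<alpha> \<phi> z * v $ \<alpha> + dzbar \<alpha> \<phi> z * cnj (v $ \<alpha>))"
proof -
  have l: "linear D" using assms has_derivative_linear by blast
  have "D v = D (\<Sum>\<alpha>\<in>UNIV. Re (v $ \<alpha>) *\<^sub>R axis \<alpha> 1 + Im (v $ \<alpha>) *\<^sub>R axis \<alpha> \<i>)"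
    by (rule arg_cong[OF vec_real_decomposition])
  also have "\<dots> = (\<Sum>\<alpha>\<in>UNIV. Re (v $ \<alpha>) *\<^sub>R D (axis \<alpha> 1) + Im (v $ \<alpha>) *\<^sub>R D (axis \<alpha> \<i>))"
    by (simp add: linear_sum[OF l] linear_add[OF l] linear_cmul[OF l])
  also have "\<dots> = (\<Sum>\<alpha>\<in>UNIV. dz \<alpha> \<phi> z * v $ \<alpha> + dzbar \<alpha> \<phi> z * cnj (v $ \<alpha>))"
  proof (rule sum.cong[OF refl])
    fix \<alpha>
    have v: "v $ \<alpha> = of_real (Re (v $ \<alpha>)) + \<i> * of_real (Im (v $ \<alpha>))"
      by (simp add: complex_eq_iff)
    have c: "cnj (v $ \<alpha>) = of_real (Re (v $ \<alpha>)) - \<i> * of_real (Im (v $ \<alpha>))"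
      by (simp add: complex_eq_iff)
    show "Re (v $ \<alpha>) *\<^sub>R D (axis \<alpha> 1) + Im (v $ \<alpha>) *\<^sub>R D (axis \<alpha> \<i>)
      = dz \<alpha> \<phi> z * v $ \<alpha> + dzbar \<alpha> \<phi> z * cnj (v $ \<alpha>)"
      unfolding dz_eq_wirtinger dzbar_eq_wirtinger wirtinger_eqI[OF assms] c
      by (subst (3) v, subst (3) v) (simp add: scaleR_conv_of_real field_simps)
  qed
  finally show ?thesis .
qed

lemma frechet_derivative_nth:
  "F differentiable (at z) \<Longrightarrow> frechet_derivative (\<lambda>y. F y $ i) (at z) v = frechet_derivative F (at z) v $ i"
  using frechet_derivative_bounded_linear_compose[OF bounded_linear_vec_nth] .

lemma smooth_on_nth: "open S \<Longrightarrow> smooth_on S F \<Longrightarrow> smooth_on S (\<lambda>y. F y $ i)"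
  by (rule smooth_on_bounded_linear_compose[OF bounded_linear_vec_nth])

lemma wirtinger_compose:
  fixes h :: "complex^'n::finite \<Rightarrow> complex" and F :: "complex^'m::finite \<Rightarrow> complex^'n"
  assumes h: "h differentiable (at (F z))" and F: "F differentiable (at z)"
  shows "wirtinger s \<alpha> (\<lambda>y. h (F y)) z = (\<Sum>j\<in>UNIV. dz j h (F z) * wirtinger s \<alpha> (\<lambda>y. F y $ j) z
    + dzbar j h (F z) * cnj (wirtinger (cnj s) \<alpha> (\<lambda>y. F y $ j) z))"
proof -
  have "((\<lambda>y. h (F y)) has_derivative (\<lambda>v. frechet_derivative h (at (F z)) (frechet_derivative F (at z) v))) (at z)"
    by (rule has_derivative_compose) (use assms in \<open>auto simp: frechet_derivative_works[symmetric]\<close>)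
  note W = wirtinger_eqI[OF this]
  show ?thesis
    unfolding W derivative_wirtinger[OF h[THEN frechet_derivative_works[THEN iffD1]]]
    by (simp add: wirtinger_def frechet_derivative_nth[OF F] sum_distrib_left sum.distrib add_divide_distrib
        sum_divide_distrib algebra_simps)
qed

section \<open>The curvature identity along a pluriharmonic map\<close>

text \<open>Contraction with the metric cancels the inverse metric inside the symbol. Thus the
  pluriharmonic equation with lowered index can be differentiated without ever differentiating
  \<open>matrix_inv\<close>.\<close>

lemma christoffel_lower:
  assumes "invertible (h w)"
  shows "(\<Sum>i\<in>UNIV. h w $ i $ q * christoffel h w i j k) = dz j (\<lambda>y. h y $ k $ q) w"
proof -
  have "matrix_inv (h w) ** h w = mat 1"
    using assms unfolding invertible_def matrix_inv_def by (rule someI2_ex) blast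
  then have I: "(\<Sum>i\<in>UNIV. matrix_inv (h w) $ l $ i * h w $ i $ q) = (if l = q then 1 else 0)" for l
    by (simp add: matrix_matrix_mult_def mat_def vec_eq_iff)
  have "(\<Sum>i\<in>UNIV. h w $ i $ q * christoffel h w i j k)
     = (\<Sum>l\<in>UNIV. (\<Sum>i\<in>UNIV. matrix_inv (h w) $ l $ i * h w $ i $ q) * dz j (\<lambda>y. h y $ k $ l) w)"
    unfolding christoffel_def metric_inv_def sum_distrib_left sum_distrib_right
    by (subst sum.swap) (simp add: mult_ac)
  also have "\<dots> = dz j (\<lambda>y. h y $ k $ q) w" unfolding I by (simp add: if_distrib if_distribR cong: if_cong)
  finally show ?thesis .
qed

text \<open>In the proof, \<open>P\<close> is \<open>\<partial>\<^sub>\<gamma> f\<close> with its index lowered by the metric; pluriharmonicity turns its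
  derivative by \<open>z\<^sup>\<alpha>\<close>-bar into \<open>Q \<alpha>\<close>, which is of first order in \<open>f\<close>. The claim is that the derivative of
  \<open>Q \<alpha>\<close> by \<open>z\<^sup>\<beta>\<close>-bar is symmetric in \<open>\<alpha>\<close> and \<open>\<beta>\<close>.\<close>

lemma pluriharmonic_curvature:
  fixes h :: "complex^'n::finite \<Rightarrow> complex^'n^'n" and F :: "complex^'m::finite \<Rightarrow> complex^'n"
  assumes S: "open S" and T: "open T" and F: "smooth_on S F" and FT: "F ` S \<subseteq> T" and h: "smooth_on T h"
    and inv: "\<And>w. w \<in> T \<Longrightarrow> invertible (h w)"
    and PH: "\<And>z \<alpha> \<beta> i. z \<in> S \<Longrightarrow> dz \<alpha> (dzbar \<beta> (\<lambda>y. F y $ i)) z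
      + (\<Sum>j\<in>UNIV. \<Sum>k\<in>UNIV. christoffel h (F z) i j k
               * dzbar \<beta> (\<lambda>y. F y $ j) z * dz \<alpha> (\<lambda>y. F y $ k) z) = 0"
    and z: "z \<in> S"
  shows "(\<Sum>j\<in>UNIV. \<Sum>l\<in>UNIV. \<Sum>s\<in>UNIV. curvature h (F z) j l s q
    * (dzbar \<beta> (\<lambda>y. F y $ j) z * cnj (dz \<alpha> (\<lambda>y. F y $ l) z)
      - dzbar \<alpha> (\<lambda>y. F y $ j) z * cnj (dz \<beta> (\<lambda>y. F y $ l) z)) * dz \<gamma> (\<lambda>y. F y $ s) z) = 0"
proof -
  define a where "a \<beta> j z = dzbar \<beta> (\<lambda>y. F y $ j) z" for \<beta> j z
  define b where "b \<alpha> k z = dz \<alpha> (\<lambda>y. F y $ k) z" for \<alpha> k z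
  define H where "H k z = h (F z) $ k $ q" for k z
  define Hd where "Hd j k z = dz j (\<lambda>y. h y $ k $ q) (F z)" for j k z
  define Hb where "Hb l k z = dzbar l (\<lambda>y. h y $ k $ q) (F z)" for l k z
  have hs: "smooth_on T (\<lambda>y. h y $ k $ r)" for k r
    by (intro smooth_on_nth T h)
  have hbs: "smooth_on T (dzbar l (\<lambda>y. h y $ k $ q))" for l k
    unfolding dzbar_eq_wirtinger by (intro smooth_on_wirtinger T hs)
  have Fs: "smooth_on S (\<lambda>y. F y $ k)" for k by (intro smooth_on_nth S F)
  have Fd: "F differentiable (at z)" if "z \<in> S" for z using F that by (rule smooth_on_imp_differentiable)
  have FzT: "F z \<in> T" if "z \<in> S" for z using FT that by blast
  have Hs: "smooth_on S (H k)" for k unfolding H_def[abs_def]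
    by (rule smooth_on_compose[OF hs F S T FT])
  have Hbs: "smooth_on S (Hb l k)" for l k unfolding Hb_def[abs_def]
    by (rule smooth_on_compose[OF hbs F S T FT])
  have as: "smooth_on S (a \<beta> j)" for \<beta> j unfolding a_def[abs_def] dzbar_eq_wirtinger
    by (intro smooth_on_wirtinger S Fs)
  have bs: "smooth_on S (b \<beta> j)" for \<beta> j unfolding b_def[abs_def] dz_eq_wirtinger
    by (intro smooth_on_wirtinger S Fs)
  have cbs: "smooth_on S (\<lambda>z. cnj (b \<beta> j z))" for \<beta> j
    by (intro smooth_on_bounded_linear_compose[OF bounded_linear_cnj] S bs)
  note [simp] = smooth_on_imp_differentiable[OF Hs] smooth_on_imp_differentiable[OF Hbs]
    smooth_on_imp_differentiable[OF bs] smooth_on_imp_differentiable[OF cbs]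
  have ba: "dzbar \<beta> (b \<gamma> k) z = dz \<gamma> (a \<beta> k) z" if "z \<in> S" for \<beta> \<gamma> k z
    unfolding a_def[abs_def] b_def[abs_def] dz_eq_wirtinger dzbar_eq_wirtinger
    by (rule wirtinger_commute[OF S Fs that])
  have low: "(\<Sum>i\<in>UNIV. H i z * dz \<gamma> (a \<beta> i) z) = - (\<Sum>k\<in>UNIV. \<Sum>j\<in>UNIV. Hd j k z * a \<beta> j z * b \<gamma> k z)"
    if z: "z \<in> S" for \<beta> \<gamma> z
  proof -
    have "dz \<gamma> (a \<beta> i) z = - (\<Sum>j\<in>UNIV. \<Sum>k\<in>UNIV. christoffel h (F z) i j k * a \<beta> j z * b \<gamma> k z)" for i
      using PH[OF z, of \<gamma> \<beta> i] unfolding a_def b_def by (simp add: eq_neg_iff_add_eq_0)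
    then have "(\<Sum>i\<in>UNIV. H i z * dz \<gamma> (a \<beta> i) z)
      = - (\<Sum>i\<in>UNIV. \<Sum>j\<in>UNIV. \<Sum>k\<in>UNIV. H i z * (christoffel h (F z) i j k * a \<beta> j z * b \<gamma> k z))"
      by (simp add: sum_negf sum_distrib_left)
    also have "\<dots> = - (\<Sum>k\<in>UNIV. \<Sum>j\<in>UNIV. \<Sum>i\<in>UNIV. H i z * (christoffel h (F z) i j k * a \<beta> j z * b \<gamma> k z))"
      by (subst sum.swap, subst (2) sum.swap, subst sum.swap) simp
    also have "\<dots> = - (\<Sum>k\<in>UNIV. \<Sum>j\<in>UNIV. (\<Sum>i\<in>UNIV. H i z * christoffel h (F z) i j k) * a \<beta> j z * b \<gamma> k z)"
      by (simp add: sum_distrib_right sum_distrib_left mult_ac)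
    finally show ?thesis unfolding H_def Hd_def christoffel_lower[of h, OF inv[OF FzT[OF z]]] .
  qed
  define P where "P z = (\<Sum>k\<in>UNIV. H k z * b \<gamma> k z)" for z
  define Q where "Q \<alpha> z = (\<Sum>k\<in>UNIV. \<Sum>l\<in>UNIV. Hb l k z * (cnj (b \<alpha> l z) * b \<gamma> k z))" for \<alpha> z
  have Ps: "smooth_on S P" unfolding P_def[abs_def] by (intro smooth_on_sum smooth_on_mult S Hs bs)
  have chain: "dzbar \<alpha> (\<lambda>y. \<phi> (F y)) z
      = (\<Sum>j\<in>UNIV. dz j \<phi> (F z) * a \<alpha> j z) + (\<Sum>j\<in>UNIV. dzbar j \<phi> (F z) * cnj (b \<alpha> j z))"
    if "z \<in> S" "smooth_on T \<phi>" for \<phi> \<alpha> z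
    using wirtinger_compose[OF smooth_on_imp_differentiable[OF that(2) FzT[OF that(1)]] Fd[OF that(1)], of \<i> \<alpha>]
    by (simp add: a_def b_def dz_eq_wirtinger dzbar_eq_wirtinger sum.distrib)
  \<comment> \<open>By the chain rule the derivative of \<open>H k\<close> splits into a part
    through \<open>a\<close> and a part through the conjugate of \<open>b\<close>. The first part
    cancels against \<open>low\<close>, the second is \<open>Q\<close>.\<close>
  have PQ: "dzbar \<alpha> P z = Q \<alpha> z" if z: "z \<in> S" for \<alpha> z
  proof -
    have "dzbar \<alpha> P z = (\<Sum>k\<in>UNIV. dzbar \<alpha> (H k) z * b \<gamma> k z + H k z * dzbar \<alpha> (b \<gamma> k) z)"
      unfolding P_def[abs_def] dzbar_eq_wirtinger using z
      by (subst wirtinger_sum) (auto intro!: sum.cong wirtinger_mult differentiable_mult)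
    also have "\<dots> = (\<Sum>k\<in>UNIV. dzbar \<alpha> (H k) z * b \<gamma> k z) + (\<Sum>k\<in>UNIV. H k z * dz \<gamma> (a \<alpha> k) z)"
      by (simp add: sum.distrib ba[OF z])
    also have "(\<Sum>k\<in>UNIV. dzbar \<alpha> (H k) z * b \<gamma> k z)
      = (\<Sum>k\<in>UNIV. \<Sum>j\<in>UNIV. Hd j k z * a \<alpha> j z * b \<gamma> k z) + Q \<alpha> z"
      unfolding H_def[abs_def] chain[OF z hs] Q_def Hd_def Hb_def
      by (simp add: sum_distrib_right sum_distrib_left distrib_right distrib_left sum.distrib mult_ac)
    finally show ?thesis unfolding low[OF z] by simp
  qed
  \<comment> \<open>\<open>E\<close> takes the terms in which the new derivative produces
    \<open>a \<beta>\<close> or its derivative, \<open>Y\<close> the remaining ones. The latter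
    contain only second derivatives of one type, of the metric or of \<open>F\<close>, and are
    symmetric in \<alpha> and \<beta> by themselves; the comparison therefore reduces to
    \<open>E\<close>.\<close>
  define E where "E \<beta> \<alpha> = (\<Sum>k\<in>UNIV. \<Sum>l\<in>UNIV. \<Sum>j\<in>UNIV. dz j (dzbar l (\<lambda>y. h y $ k $ q)) (F z) * a \<beta> j z * (cnj (b \<alpha> l z) * b \<gamma> k z))
     + (\<Sum>k\<in>UNIV. \<Sum>l\<in>UNIV. Hb l k z * (cnj (b \<alpha> l z) * dz \<gamma> (a \<beta> k) z))" for \<alpha> \<beta>
  define Y where "Y \<beta> \<alpha> = (\<Sum>k\<in>UNIV. \<Sum>l\<in>UNIV. \<Sum>m\<in>UNIV. dzbar m (dzbar l (\<lambda>y. h y $ k $ q)) (F z) * cnj (b \<beta> m z) * (cnj (b \<alpha> l z) * b \<gamma> k z))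
     + (\<Sum>k\<in>UNIV. \<Sum>l\<in>UNIV. Hb l k z * (cnj (dz \<beta> (b \<alpha> l) z) * b \<gamma> k z))" for \<alpha> \<beta>
  have dQ: "dzbar \<beta> (Q \<alpha>) z = E \<beta> \<alpha> + Y \<beta> \<alpha>" for \<alpha> \<beta>
  proof -
    have "dzbar \<beta> (Q \<alpha>) z = (\<Sum>k\<in>UNIV. \<Sum>l\<in>UNIV. dzbar \<beta> (Hb l k) z * (cnj (b \<alpha> l z) * b \<gamma> k z)
        + Hb l k z * (cnj (dz \<beta> (b \<alpha> l) z) * b \<gamma> k z + cnj (b \<alpha> l z) * dzbar \<beta> (b \<gamma> k) z))"
      unfolding Q_def[abs_def] dzbar_eq_wirtinger dz_eq_wirtinger using z
      by (simp add: wirtinger_sum wirtinger_mult wirtinger_cnj)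
    also have "\<dots> = E \<beta> \<alpha> + Y \<beta> \<alpha>"
      unfolding E_def Y_def ba[OF z] unfolding Hb_def[abs_def] chain[OF z hbs]
      by (simp add: sum_distrib_right sum_distrib_left distrib_right distrib_left sum.distrib)
    finally show ?thesis .
  qed
  have "Y \<beta> \<alpha> = Y \<alpha> \<beta>"
  proof -
    have 1: "dzbar m (dzbar l (\<lambda>y. h y $ k $ q)) (F z) = dzbar l (dzbar m (\<lambda>y. h y $ k $ q)) (F z)" for k l m
      unfolding dzbar_eq_wirtinger by (rule wirtinger_commute[OF T hs FzT[OF z]])
    have 2: "dz \<beta> (b \<alpha> l) z = dz \<alpha> (b \<beta> l) z" for l
      unfolding b_def[abs_def] dz_eq_wirtinger by (rule wirtinger_commute[OF S Fs z])
    have 3: "(\<Sum>l\<in>UNIV. \<Sum>m\<in>UNIV. dzbar m (dzbar l (\<lambda>y. h y $ k $ q)) (F z) * cnj (b \<beta> m z) * (cnj (b \<alpha> l z) * b \<gamma> k z))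
     = (\<Sum>l\<in>UNIV. \<Sum>m\<in>UNIV. dzbar m (dzbar l (\<lambda>y. h y $ k $ q)) (F z) * cnj (b \<alpha> m z) * (cnj (b \<beta> l z) * b \<gamma> k z))" for k
      by (subst sum.swap) (simp add: 1 mult_ac)
    show ?thesis unfolding Y_def 2 3 ..
  qed
  moreover have "dzbar \<beta> (Q \<alpha>) z = dzbar \<alpha> (Q \<beta>) z"
  proof -
    have "dzbar \<beta> (Q \<alpha>) z = dzbar \<beta> (dzbar \<alpha> P) z" for \<alpha> \<beta>
      unfolding dzbar_eq_wirtinger[of \<beta>]
      by (rule wirtinger_cong[OF S z, symmetric])
        (auto simp: PQ[symmetric] dzbar_eq_wirtinger intro!: smooth_on_imp_differentiable[OF _ z] smooth_on_wirtinger S Ps)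
    then show ?thesis unfolding dzbar_eq_wirtinger by (simp add: wirtinger_commute[OF S Ps z])
  qed
  ultimately have EE: "E \<beta> \<alpha> = E \<alpha> \<beta>" unfolding dQ by simp
  \<comment> \<open>Inserting the pluriharmonic equation for
    \<open>dz \<gamma> (a \<beta> k)\<close> produces the inverse metric \<open>G\<close> and turns
    the second sum of \<open>E\<close> into the quadratic term of the curvature; the first sum is
    already the second-derivative term. The chain of exchanged sums only brings both into the common
    order \<open>j\<close>, \<open>l\<close>, \<open>s\<close>.\<close>
  have E: "E \<beta> \<alpha> = - (\<Sum>j\<in>UNIV. \<Sum>l\<in>UNIV. \<Sum>s\<in>UNIV. curvature h (F z) j l s q * (a \<beta> j z * cnj (b \<alpha> l z)) * b \<gamma> s z)" for \<alpha> \<beta>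
  proof -
    define G where "G p r = metric_inv (h (F z)) p r" for p r
    have D: "dz \<gamma> (a \<beta> k) z = - (\<Sum>j\<in>UNIV. \<Sum>s\<in>UNIV. \<Sum>p\<in>UNIV. G k p * dz j (\<lambda>y. h y $ s $ p) (F z) * a \<beta> j z * b \<gamma> s z)" for k
      using PH[OF z, of \<gamma> \<beta> k] unfolding a_def b_def christoffel_def G_def
      by (simp add: eq_neg_iff_add_eq_0 sum_distrib_right)
    have 1: "(\<Sum>k\<in>UNIV. \<Sum>l\<in>UNIV. \<Sum>j\<in>UNIV. dz j (dzbar l (\<lambda>y. h y $ k $ q)) (F z) * a \<beta> j z * (cnj (b \<alpha> l z) * b \<gamma> k z))
      = (\<Sum>j\<in>UNIV. \<Sum>l\<in>UNIV. \<Sum>s\<in>UNIV. dz j (dzbar l (\<lambda>y. h y $ s $ q)) (F z) * (a \<beta> j z * cnj (b \<alpha> l z)) * b \<gamma> s z)"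
      by (subst sum.swap, subst (2) sum.swap, subst sum.swap) (simp add: mult_ac)
    have "(\<Sum>k\<in>UNIV. \<Sum>l\<in>UNIV. Hb l k z * (cnj (b \<alpha> l z) * dz \<gamma> (a \<beta> k) z))
      = - (\<Sum>k\<in>UNIV. \<Sum>l\<in>UNIV. \<Sum>j\<in>UNIV. \<Sum>s\<in>UNIV. \<Sum>p\<in>UNIV.
          Hb l k z * (cnj (b \<alpha> l z) * (G k p * dz j (\<lambda>y. h y $ s $ p) (F z) * a \<beta> j z * b \<gamma> s z)))"
      unfolding D by (simp add: sum_negf sum_distrib_left)
    also have "\<dots> = - (\<Sum>k\<in>UNIV. \<Sum>j\<in>UNIV. \<Sum>l\<in>UNIV. \<Sum>s\<in>UNIV. \<Sum>p\<in>UNIV.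
          Hb l k z * (cnj (b \<alpha> l z) * (G k p * dz j (\<lambda>y. h y $ s $ p) (F z) * a \<beta> j z * b \<gamma> s z)))"
      by (subst (2) sum.swap) simp
    also have "\<dots> = - (\<Sum>j\<in>UNIV. \<Sum>k\<in>UNIV. \<Sum>l\<in>UNIV. \<Sum>s\<in>UNIV. \<Sum>p\<in>UNIV.
          Hb l k z * (cnj (b \<alpha> l z) * (G k p * dz j (\<lambda>y. h y $ s $ p) (F z) * a \<beta> j z * b \<gamma> s z)))"
      by (subst sum.swap) simp
    also have "\<dots> = - (\<Sum>j\<in>UNIV. \<Sum>l\<in>UNIV. \<Sum>k\<in>UNIV. \<Sum>s\<in>UNIV. \<Sum>p\<in>UNIV.
          Hb l k z * (cnj (b \<alpha> l z) * (G k p * dz j (\<lambda>y. h y $ s $ p) (F z) * a \<beta> j z * b \<gamma> s z)))"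
      by (subst (2) sum.swap) simp
    also have "\<dots> = - (\<Sum>j\<in>UNIV. \<Sum>l\<in>UNIV. \<Sum>s\<in>UNIV. \<Sum>k\<in>UNIV. \<Sum>p\<in>UNIV.
          Hb l k z * (cnj (b \<alpha> l z) * (G k p * dz j (\<lambda>y. h y $ s $ p) (F z) * a \<beta> j z * b \<gamma> s z)))"
      by (subst (3) sum.swap) simp
    finally have 2: "(\<Sum>k\<in>UNIV. \<Sum>l\<in>UNIV. Hb l k z * (cnj (b \<alpha> l z) * dz \<gamma> (a \<beta> k) z)) = \<dots>" .
    show ?thesis unfolding E_def 1 2 curvature_def G_def[symmetric] Hb_def[symmetric]
      by (simp add: sum_distrib_right sum_distrib_left distrib_right left_diff_distrib right_diff_distrib
          sum_subtractf sum_negf sum.distrib mult_ac)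
  qed
  from EE show ?thesis unfolding E a_def b_def
    by (simp add: right_diff_distrib left_diff_distrib sum_subtractf)
qed

section \<open>Rank and unique continuation in local coordinates\<close>

text \<open>The quadratic curvature form at the vectors \<open>a \<beta>\<close>,
  \<open>b \<alpha>\<close>, \<open>a \<alpha>\<close>, \<open>b \<beta>\<close> is a combination of
  instances of the assumed identity: take \<gamma> = \<alpha> with weights
  \<open>cnj (a \<beta> l)\<close>, subtract \<gamma> = \<beta> with weights
  \<open>cnj (a \<alpha> l)\<close>, and sum over the free index \<open>q = l\<close>.\<close>

lemma nondegenerate_wedge:
  fixes W :: "'n::finite \<Rightarrow> 'n \<Rightarrow> 'n \<Rightarrow> 'n \<Rightarrow> complex" and a b :: "'m \<Rightarrow> 'n \<Rightarrow> complex"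
  assumes nd: "\<And>a b c e :: complex^'n. (\<Sum>i\<in>UNIV. \<Sum>j\<in>UNIV. \<Sum>k\<in>UNIV. \<Sum>l\<in>UNIV. W i j k l
            * (a $ i * cnj (b $ j) - c $ i * cnj (e $ j))
            * cnj (a $ l * cnj (b $ k) - c $ l * cnj (e $ k))) = 0
        \<longleftrightarrow> (\<forall>i j. a $ i * cnj (b $ j) - c $ i * cnj (e $ j) = 0)"
    and z: "\<And>\<alpha> \<beta> \<gamma> q. (\<Sum>j\<in>UNIV. \<Sum>l\<in>UNIV. \<Sum>s\<in>UNIV. W j l s q
      * (a \<beta> j * cnj (b \<alpha> l) - a \<alpha> j * cnj (b \<beta> l)) * b \<gamma> s) = 0"
  shows "a \<beta> i * cnj (b \<alpha> j) = a \<alpha> i * cnj (b \<beta> j)"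
proof -
  define X where "X \<gamma> q = (\<Sum>j\<in>UNIV. \<Sum>l\<in>UNIV. \<Sum>s\<in>UNIV. W j l s q
      * (a \<beta> j * cnj (b \<alpha> l) - a \<alpha> j * cnj (b \<beta> l)) * b \<gamma> s)" for \<gamma> q
  have X: "X \<gamma> q = 0" for \<gamma> q unfolding X_def by (rule z)
  have "(\<Sum>i\<in>UNIV. \<Sum>j\<in>UNIV. \<Sum>k\<in>UNIV. \<Sum>l\<in>UNIV. W i j k l
            * (a \<beta> i * cnj (b \<alpha> j) - a \<alpha> i * cnj (b \<beta> j))
            * cnj (a \<beta> l * cnj (b \<alpha> k) - a \<alpha> l * cnj (b \<beta> k)))
     = (\<Sum>l\<in>UNIV. \<Sum>i\<in>UNIV. \<Sum>j\<in>UNIV. \<Sum>k\<in>UNIV. W i j k l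
            * (a \<beta> i * cnj (b \<alpha> j) - a \<alpha> i * cnj (b \<beta> j))
            * cnj (a \<beta> l * cnj (b \<alpha> k) - a \<alpha> l * cnj (b \<beta> k)))"
    by (subst (3) sum.swap, subst (2) sum.swap, subst sum.swap) simp
  also have "\<dots> = (\<Sum>l\<in>UNIV. cnj (a \<beta> l) * X \<alpha> l - cnj (a \<alpha> l) * X \<beta> l)"
    unfolding X_def by (simp add: sum_distrib_left sum_subtractf sum.distrib algebra_simps)
  also have "\<dots> = 0" unfolding X by simp
  finally show ?thesis
    using nd[of "\<chi> i. a \<beta> i" "\<chi> j. b \<alpha> j" "\<chi> i. a \<alpha> i" "\<chi> j. b \<beta> j"] by simp
qed

text \<open>A nonzero entry \<open>a \<gamma> i\<close> can be divided out of the wedge relation,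
  which makes every \<open>b \<alpha>\<close> a multiple of \<open>b \<gamma>\<close>, so that all 2
  x 2 minors of \<open>b\<close> vanish.\<close>

lemma wedge_minor_zero:
  fixes a b :: "'m \<Rightarrow> 'n \<Rightarrow> complex"
  assumes W: "\<And>\<alpha> \<beta> i j. a \<beta> i * cnj (b \<alpha> j) = a \<alpha> i * cnj (b \<beta> j)"
    and minor: "b \<alpha> j * b \<beta> k \<noteq> b \<beta> j * b \<alpha> k"
  shows "a \<gamma> i = 0"
proof (rule ccontr)
  assume n: "a \<gamma> i \<noteq> 0"
  define c where "c \<alpha> = cnj (a \<alpha> i / a \<gamma> i)" for \<alpha>
  have "b \<alpha> j = c \<alpha> * b \<gamma> j" for \<alpha> j
  proof -
    have "cnj (b \<alpha> j) = (a \<alpha> i / a \<gamma> i) * cnj (b \<gamma> j)"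
      using W[of \<gamma> i \<alpha> j] n by (simp add: field_simps)
    then have "cnj (cnj (b \<alpha> j)) = cnj ((a \<alpha> i / a \<gamma> i) * cnj (b \<gamma> j))" by simp
    then show ?thesis unfolding c_def by simp
  qed
  then have "b \<alpha> j * b \<beta> k = (c \<alpha> * b \<gamma> j) * (c \<beta> * b \<gamma> k)" "b \<beta> j * b \<alpha> k = (c \<beta> * b \<gamma> j) * (c \<alpha> * b \<gamma> k)"
    by metis+
  then show False using minor by simp
qed

text \<open>\<open>D v\<close> depends on \<open>v\<close> only through the complex number
  \<open>s\<close> that pairs \<open>c\<close> with the conjugate of \<open>v\<close>, so
  \<open>D\<close> factors through a real plane.\<close>

lemma dim_range_le_2:
  fixes D :: "complex^'m::finite \<Rightarrow> complex^'n::finite"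
  assumes D: "\<And>v i. D v $ i = (\<Sum>\<alpha>\<in>UNIV. b \<alpha> i * v $ \<alpha> + a \<alpha> i * cnj (v $ \<alpha>))"
    and a: "\<And>\<alpha> i. a \<alpha> i = c \<alpha> * y i" and b: "\<And>\<alpha> i. b \<alpha> i = cnj (c \<alpha>) * x i"
  shows "dim (range D) \<le> 2"
proof -
  \<comment> \<open>\<open>e1\<close> and \<open>e2\<close> are the values of
    \<open>x i * cnj s + y i * s\<close> at \<open>s = 1\<close> and at
    \<open>s = \<i>\<close>.\<close>
  define e1 where "e1 = (\<chi> i. x i + y i)"
  define e2 where "e2 = (\<chi> i. \<i> * (y i - x i))"
  have "D v \<in> span {e1, e2}" for v
  proof -
    define s where "s = (\<Sum>\<alpha>\<in>UNIV. c \<alpha> * cnj (v $ \<alpha>))"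
    have "D v $ i = x i * cnj s + y i * s" for i
      unfolding D a b s_def by (simp add: sum.distrib sum_distrib_left mult_ac)
    then have "D v = Re s *\<^sub>R e1 + Im s *\<^sub>R e2"
      unfolding e1_def e2_def by (simp add: vec_eq_iff complex_eq_iff algebra_simps)
    then show ?thesis by (simp add: span_add span_base span_scale)
  qed
  then have "range D \<subseteq> span {e1, e2}" by blast
  then have "dim (range D) \<le> card {e1, e2}" by (rule dim_le_card) simp
  also have "\<dots> \<le> 2" by (simp add: card_insert_if)
  finally show ?thesis .
qed

text \<open>If all minors vanish and some \<open>a \<gamma> i\<close> is nonzero, the minors of
  \<open>a\<close> make every \<open>a \<alpha>\<close> a multiple of \<open>a \<gamma>\<close>, and
  the wedge relation makes \<open>b \<alpha>\<close> the conjugate multiple of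
  \<open>b \<gamma>\<close>; this is the shape that forces rank at most 2. If \<open>a\<close> is
  zero, the minors of \<open>b\<close> give the same shape.\<close>

lemma rank_ge_3_minor:
  fixes D :: "complex^'m::finite \<Rightarrow> complex^'n::finite"
  assumes D: "\<And>v i. D v $ i = (\<Sum>\<alpha>\<in>UNIV. b \<alpha> i * v $ \<alpha> + a \<alpha> i * cnj (v $ \<alpha>))"
    and W: "\<And>\<alpha> \<beta> i j. a \<beta> i * cnj (b \<alpha> j) = a \<alpha> i * cnj (b \<beta> j)"
    and rank: "3 \<le> dim (range D)"
  shows "(\<exists>\<alpha> \<beta> j k. b \<alpha> j * b \<beta> k \<noteq> b \<beta> j * b \<alpha> k) \<or> (\<exists>\<alpha> \<beta> j k. a \<alpha> j * a \<beta> k \<noteq> a \<beta> j * a \<alpha> k)"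
proof (rule ccontr)
  assume neg: "\<not> ?thesis"
  then have mb: "b \<alpha> j * b \<beta> k = b \<beta> j * b \<alpha> k" and ma: "a \<alpha> j * a \<beta> k = a \<beta> j * a \<alpha> k" for \<alpha> \<beta> j k
    by blast+
  have "dim (range D) \<le> 2"
  proof (cases "\<exists>\<gamma> i. a \<gamma> i \<noteq> 0")
    case True
    then obtain \<gamma> i where n: "a \<gamma> i \<noteq> 0" by blast
    show ?thesis
    proof (rule dim_range_le_2[OF D, where c = "\<lambda>\<alpha>. a \<alpha> i / a \<gamma> i" and y = "a \<gamma>" and x = "b \<gamma>"])
      show "a \<alpha> j = a \<alpha> i / a \<gamma> i * a \<gamma> j" for \<alpha> j
        using ma[of \<alpha> j \<gamma> i] n by (simp add: field_simps)
      show "b \<alpha> j = cnj (a \<alpha> i / a \<gamma> i) * b \<gamma> j" for \<alpha> j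
      proof -
        have "cnj (a \<gamma> i * cnj (b \<alpha> j)) = cnj (a \<alpha> i * cnj (b \<gamma> j))" using W[of \<gamma> i \<alpha> j] by simp
        then show ?thesis using n by (simp add: field_simps)
      qed
    qed
  next
    case False
    then have a0: "a \<alpha> i = 0" for \<alpha> i by blast
    show ?thesis
    proof (cases "\<exists>\<gamma> j. b \<gamma> j \<noteq> 0")
      case True
      then obtain \<gamma> i where n: "b \<gamma> i \<noteq> 0" by blast
      show ?thesis
      proof (rule dim_range_le_2[OF D, where c = "\<lambda>\<alpha>. cnj (b \<alpha> i / b \<gamma> i)" and y = "\<lambda>_. 0" and x = "b \<gamma>"])
        show "b \<alpha> j = cnj (cnj (b \<alpha> i / b \<gamma> i)) * b \<gamma> j" for \<alpha> j
          using mb[of \<alpha> j \<gamma> i] n by (simp add: field_simps)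
      qed (simp add: a0)
    next
      case False
      then show ?thesis
        by (intro dim_range_le_2[OF D, where c = "\<lambda>_. 0" and x = "\<lambda>_. 0" and y = "\<lambda>_. 0"]) (auto simp: a0)
    qed
  qed
  then show False using rank by simp
qed

section \<open>Unique continuation for linear systems in Wirtinger derivatives\<close>

text \<open>Replacing \<open>v\<close> by \<open>\<i> *s v\<close> multiplies the complex linear
  part of \<open>D\<close> by \<open>\<i>\<close> and the conjugate linear part by
  \<open>- \<i>\<close>; the combination cancels one part and doubles the other.\<close>

lemma derivative_wirtinger_combination:
  assumes "(\<phi> has_derivative D) (at z)" "s = \<i> \<or> s = - \<i>"
  shows "D v + s * D (\<i> *s v) = (\<Sum>\<alpha>\<in>UNIV. 2 * wirtinger s \<alpha> \<phi> z * (if s = \<i> then cnj (v $ \<alpha>) else v $ \<alpha>))"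
  using assms(2) unfolding derivative_wirtinger[OF assms(1)] dz_eq_wirtinger dzbar_eq_wirtinger
  by (auto simp: sum_distrib_left sum.distrib[symmetric] algebra_simps intro!: sum.cong)

lemma norm_le_sum_nth: "norm (x :: complex^'n::finite) \<le> (\<Sum>i\<in>UNIV. cmod (x $ i))"
  unfolding norm_vec_def by (rule L2_set_le_sum) simp

text \<open>The Cauchy--Riemann operator in any direction is a combination of the given Wirtinger
  derivatives, hence of the components of \<open>u\<close> with coefficients from \<open>C\<close>.
  Continuity of \<open>C\<close> on the closed ball, which is compact, makes these bounded and
  yields the inequality for \<open>cauchy_riemann_unique_continuation\<close>.\<close>

lemma wirtinger_system_unique_continuation:
  fixes u :: "complex^'m::finite \<Rightarrow> complex^'n::finite"
  assumes u: "smooth_on (ball z0 R) u" and s: "s = \<i> \<or> s = - \<i>"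
    and C: "\<And>\<alpha> i j. continuous_on (cball z0 R) (C \<alpha> i j)"
    and eq: "\<And>z \<alpha> i. z \<in> ball z0 R \<Longrightarrow> wirtinger s \<alpha> (\<lambda>y. u y $ i) z = (\<Sum>j\<in>UNIV. C \<alpha> i j z * u z $ j)"
    and r: "0 < r" and zero: "\<And>z. z \<in> ball z0 r \<Longrightarrow> u z = 0"
    and z1: "z1 \<in> ball z0 R"
  shows "u z1 = 0"
proof -
  have "\<exists>M. \<forall>z\<in>cball z0 R. cmod (C \<alpha> i j z) \<le> M" for \<alpha> i j
    using compact_imp_bounded[OF compact_continuous_image[OF C compact_cball]]
    unfolding bounded_iff by auto
  then obtain M where M: "\<And>\<alpha> i j z. z \<in> cball z0 R \<Longrightarrow> cmod (C \<alpha> i j z) \<le> M \<alpha> i j" by metis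
  define N where "N = (\<Sum>\<alpha>\<in>UNIV. \<Sum>i\<in>UNIV. \<Sum>j\<in>UNIV. \<bar>M \<alpha> i j\<bar>)"
  show ?thesis
  proof (rule cauchy_riemann_unique_continuation[OF u _ _ r zero z1, where s = s and K = "2 * N"])
    show "Re s = 0" using s by auto
    fix z b assume z: "z \<in> ball z0 R"
    have du: "u differentiable (at z)" by (rule smooth_on_imp_differentiable[OF u z])
    let ?D = "frechet_derivative u (at z)"
    have comp: "cmod (?D b $ i + s * ?D (\<i> *s b) $ i) \<le> 2 * (\<Sum>\<alpha>\<in>UNIV. \<Sum>j\<in>UNIV. \<bar>M \<alpha> i j\<bar>) * norm b * norm (u z)" for i
    proof -
      have "((\<lambda>y. u y $ i) has_derivative (\<lambda>v. ?D v $ i)) (at z)"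
        by (rule bounded_linear.has_derivative[OF bounded_linear_vec_nth smooth_on_has_derivative[OF u z]])
      from derivative_wirtinger_combination[OF this s, of b]
      have "cmod (?D b $ i + s * ?D (\<i> *s b) $ i)
        = cmod (\<Sum>\<alpha>\<in>UNIV. 2 * (\<Sum>j\<in>UNIV. C \<alpha> i j z * u z $ j) * (if s = \<i> then cnj (b $ \<alpha>) else b $ \<alpha>))"
        using eq[OF z] by simp
      also have "\<dots> \<le> (\<Sum>\<alpha>\<in>UNIV. 2 * (\<Sum>j\<in>UNIV. \<bar>M \<alpha> i j\<bar> * norm (u z)) * norm b)"
      proof (rule sum_norm_le)
        fix \<alpha>
        have "cmod (\<Sum>j\<in>UNIV. C \<alpha> i j z * u z $ j) \<le> (\<Sum>j\<in>UNIV. \<bar>M \<alpha> i j\<bar> * norm (u z))"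
        proof (rule sum_norm_le)
          fix j
          have "cmod (C \<alpha> i j z) \<le> \<bar>M \<alpha> i j\<bar>" using M[of z \<alpha> i j] z by simp
          then show "cmod (C \<alpha> i j z * u z $ j) \<le> \<bar>M \<alpha> i j\<bar> * norm (u z)"
            unfolding norm_mult by (intro mult_mono Finite_Cartesian_Product.norm_nth_le) auto
        qed
        moreover have "cmod (if s = \<i> then cnj (b $ \<alpha>) else b $ \<alpha>) \<le> norm b"
          using Finite_Cartesian_Product.norm_nth_le[of b \<alpha>] by auto
        ultimately show "cmod (2 * (\<Sum>j\<in>UNIV. C \<alpha> i j z * u z $ j) * (if s = \<i> then cnj (b $ \<alpha>) else b $ \<alpha>))
          \<le> 2 * (\<Sum>j\<in>UNIV. \<bar>M \<alpha> i j\<bar> * norm (u z)) * norm b"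
          unfolding norm_mult by (intro mult_mono) (auto intro!: sum_nonneg)
      qed
      also have "\<dots> = 2 * (\<Sum>\<alpha>\<in>UNIV. \<Sum>j\<in>UNIV. \<bar>M \<alpha> i j\<bar>) * norm b * norm (u z)"
        by (simp add: sum_distrib_left sum_distrib_right mult_ac)
      finally show ?thesis .
    qed
    have "norm (?D b + s *s ?D (\<i> *s b)) \<le> (\<Sum>i\<in>UNIV. 2 * (\<Sum>\<alpha>\<in>UNIV. \<Sum>j\<in>UNIV. \<bar>M \<alpha> i j\<bar>) * norm b * norm (u z))"
      by (rule order_trans[OF norm_le_sum_nth]) (use comp in \<open>auto intro!: sum_mono\<close>)
    also have "\<dots> = 2 * N * norm b * norm (u z)"
      unfolding N_def by (subst (3) sum.swap) (simp add: sum_distrib_left sum_distrib_right mult_ac)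
    finally show "norm (?D b + s *s ?D (\<i> *s b)) \<le> 2 * N * norm b * norm (u z)" .
  qed
qed

section \<open>Continuity of the inverse metric\<close>

lemma continuous_on_det:
  fixes h :: "'a::topological_space \<Rightarrow> complex^'n::finite^'n"
  assumes "\<And>i j. continuous_on T (\<lambda>w. h w $ i $ j)"
  shows "continuous_on T (\<lambda>w. det (h w))"
  unfolding det_def by (intro continuous_intros assms)

text \<open>Cramer's rule: column \<open>i\<close> of the inverse solves the linear system with
  right-hand side \<open>axis i 1\<close>, so each entry is a quotient of determinants.
  \<open>G\<close> is the matrix with column \<open>l\<close> replaced by that right-hand
  side.\<close>

lemma continuous_on_matrix_inv:
  fixes h :: "'a::topological_space \<Rightarrow> complex^'n::finite^'n"
  assumes h: "\<And>i j. continuous_on T (\<lambda>w. h w $ i $ j)" and inv: "\<And>w. w \<in> T \<Longrightarrow> invertible (h w)"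
  shows "continuous_on T (\<lambda>w. matrix_inv (h w) $ l $ i)"
proof -
  define G where "G w = (\<chi> p q. if q = l then axis i 1 $ p else h w $ p $ q)" for w
  have "det (G w) / det (h w) = matrix_inv (h w) $ l $ i" if w: "w \<in> T" for w
  proof -
    have "h w ** matrix_inv (h w) = mat 1"
      using inv[OF w] unfolding invertible_def matrix_inv_def by (rule someI2_ex) blast
    then have "h w *v (matrix_inv (h w) *v axis i 1) = axis i 1"
      by (simp add: matrix_vector_mul_assoc)
    then have "(matrix_inv (h w) *v axis i 1) $ l = det (G w) / det (h w)"
      unfolding cramer[OF invertible_det_nz[THEN iffD1, OF inv[OF w]]] G_def by simp
    moreover have "(matrix_inv (h w) *v axis i 1) $ l = matrix_inv (h w) $ l $ i"
      by (simp add: matrix_vector_mult_def axis_def if_distrib[of "\<lambda>x. _ * x"] cong: if_cong)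
    ultimately show ?thesis by simp
  qed
  moreover have "continuous_on T (\<lambda>w. det (G w) / det (h w))"
  proof (intro continuous_on_divide continuous_on_det h)
    show "continuous_on T (\<lambda>w. G w $ p $ q)" for p q
      unfolding G_def by (cases "q = l") (simp_all add: h)
    show "\<forall>w\<in>T. det (h w) \<noteq> 0" using inv invertible_det_nz by blast
  qed
  ultimately show ?thesis by (metis (no_types, lifting) continuous_on_cong)
qed

text \<open>A kernel vector \<open>x\<close> must be conjugated before it is tested, because
  \<open>herm\<close> conjugates its second argument: at \<open>v\<close>, the conjugate of
  \<open>x\<close>, the form pairs \<open>v\<close> with \<open>H *v x = 0\<close>.\<close>

lemma invertible_positive:
  fixes H :: "complex^'n::finite^'n"
  assumes "\<And>v. v \<noteq> 0 \<Longrightarrow> 0 < Re (herm H v v)"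
  shows "invertible H"
proof -
  have "x = 0" if x: "H *v x = 0" for x
  proof (rule ccontr)
    define v where "v = (\<chi> k. cnj (x $ k))"
    assume "x \<noteq> 0"
    then have "v \<noteq> 0" unfolding v_def by (simp add: vec_eq_iff)
    have "herm H v v = (\<Sum>k\<in>UNIV. v $ k * (H *v x) $ k)"
      unfolding herm_def matrix_vector_mult_def v_def by (simp add: sum_distrib_left mult_ac)
    then have "herm H v v = 0" unfolding x by simp
    then show False using assms[OF \<open>v \<noteq> 0\<close>] by simp
  qed
  then show ?thesis
    using matrix_left_invertible_ker[of H] invertible_left_inverse[of H] by blast
qed

text \<open>The derivative of \<open>F\<close> at \<open>z\<close> is complex linear for \<open>s = \<i>\<close>, conjugate linear for \<open>s = - \<i>\<close>.\<close>

definition cr_at :: "complex \<Rightarrow> (complex^'m \<Rightarrow> complex^'n) \<Rightarrow> complex^'m::finite \<Rightarrow> bool" where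
  "cr_at s F z \<longleftrightarrow> (\<exists>D. (F has_derivative D) (at z) \<and> (\<forall>v. D (\<i> *s v) = s *s D v))"

lemma axis_scale: "\<i> *s axis \<alpha> (1::complex) = axis \<alpha> \<i>"
  by (simp add: vec_eq_iff axis_def)

lemma cr_at_iff_wirtinger:
  fixes F :: "complex^'m::finite \<Rightarrow> complex^'n::finite"
  assumes F: "F differentiable (at z)" and s: "s = \<i> \<or> s = - \<i>"
  shows "cr_at s F z \<longleftrightarrow> (\<forall>\<alpha> i. wirtinger s \<alpha> (\<lambda>y. F y $ i) z = 0)"
proof
  have comp: "((\<lambda>y. F y $ i) has_derivative (\<lambda>v. D v $ i)) (at z)" if "(F has_derivative D) (at z)" for D i
    using bounded_linear.has_derivative[OF bounded_linear_vec_nth that] .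
  have ss: "s * s = -1" using s by auto
  {
    assume "cr_at s F z"
    then obtain D where D: "(F has_derivative D) (at z)" and lin: "\<And>v. D (\<i> *s v) = s *s D v"
      unfolding cr_at_def by blast
    have "D (axis \<alpha> \<i>) $ i = s * D (axis \<alpha> 1) $ i" for \<alpha> i
      using lin[of "axis \<alpha> 1"] by (simp add: axis_scale)
    then show "\<forall>\<alpha> i. wirtinger s \<alpha> (\<lambda>y. F y $ i) z = 0"
      using ss by (simp add: wirtinger_eqI[OF comp[OF D]] mult.assoc[symmetric])
  next
    assume w: "\<forall>\<alpha> i. wirtinger s \<alpha> (\<lambda>y. F y $ i) z = 0"
    define D where "D = frechet_derivative F (at z)"
    have D: "(F has_derivative D) (at z)" unfolding D_def using F by (simp add: frechet_derivative_works)
    have 0: "D v $ i + s * D (\<i> *s v) $ i = 0" for v i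
      using derivative_wirtinger_combination[OF comp[OF D] s] w by simp
    have "D (\<i> *s v) $ i = s * D v $ i" for v i
    proof -
      have "s * (D v $ i + s * D (\<i> *s v) $ i) = s * D v $ i - D (\<i> *s v) $ i"
        using ss by (simp add: distrib_left mult.assoc[symmetric])
      then show ?thesis unfolding 0 by simp
    qed
    then have "D (\<i> *s v) = s *s D v" for v by (simp add: vec_eq_iff)
    then show "cr_at s F z" unfolding cr_at_def using D by blast
  }
qed

text \<open>Real linearity extends the rule from \<open>\<i>\<close> to all scalars. The resulting
  factor is \<open>c\<close> for \<open>s = \<i>\<close> and \<open>cnj c\<close> for
  \<open>s = - \<i>\<close>, as the definitions of holomorphic and antiholomorphic maps
  demand.\<close>

lemma cr_at_scale:
  assumes "(F has_derivative D) (at z)" "\<And>v. D (\<i> *s v) = s *s D v"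
  shows "D (c *s v) = (complex_of_real (Re c) + complex_of_real (Im c) * s) *s D v"
proof -
  have l: "linear D" using assms(1) has_derivative_linear by blast
  have c: "c *s v = Re c *\<^sub>R v + Im c *\<^sub>R (\<i> *s v)"
    by (simp add: vec_eq_iff complex_eq_iff)
  show ?thesis unfolding c linear_add[OF l] linear_cmul[OF l] assms(2)
    by (rule vec_eq_iff[THEN iffD2]) (simp add: complex_eq_iff algebra_simps)
qed

section \<open>Pluriharmonic maps in coordinates\<close>

text \<open>Everything that the local analysis needs about one pair of charts, free of manifolds:
  \<open>F\<close> is the map in coordinates and \<open>h\<close> the metric, whose positivity
  enters through \<open>inv\<close>.\<close>

locale pluriharmonic_rep =
  fixes S :: "(complex^'m::finite) set" and T :: "(complex^'n::finite) set"
    and F :: "complex^'m \<Rightarrow> complex^'n" and h :: "complex^'n \<Rightarrow> complex^'n^'n"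
  assumes open_S: "open S" and open_T: "open T" and smooth_F: "smooth_on S F" and maps: "F ` S \<subseteq> T"
    and smooth_h: "smooth_on T h" and inv: "\<And>w. w \<in> T \<Longrightarrow> invertible (h w)"
    and PH: "\<And>z \<alpha> \<beta> i. z \<in> S \<Longrightarrow> dz \<alpha> (dzbar \<beta> (\<lambda>y. F y $ i)) z
      + (\<Sum>j\<in>UNIV. \<Sum>k\<in>UNIV. christoffel h (F z) i j k
               * dzbar \<beta> (\<lambda>y. F y $ j) z * dz \<alpha> (\<lambda>y. F y $ k) z) = 0"
begin

lemma smooth_F_wirtinger: "smooth_on S (wirtinger s \<alpha> (\<lambda>y. F y $ i))"
  by (intro smooth_on_wirtinger open_S smooth_on_nth smooth_F)

lemma cr_iff: "z \<in> S \<Longrightarrow> s = \<i> \<or> s = - \<i> \<Longrightarrow> cr_at s F z \<longleftrightarrow> (\<forall>\<alpha> i. wirtinger s \<alpha> (\<lambda>y. F y $ i) z = 0)"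
  using cr_at_iff_wirtinger smooth_on_imp_differentiable[OF smooth_F] by blast

lemma continuous_on_christoffel: "continuous_on S (\<lambda>z. christoffel h (F z) i j k)"
proof -
  have hs: "smooth_on T (\<lambda>w. h w $ p $ q)" for p q
    by (intro smooth_on_nth open_T smooth_h)
  have "continuous_on T (\<lambda>w. christoffel h w i j k)"
    unfolding christoffel_def metric_inv_def dz_eq_wirtinger
    by (intro continuous_on_sum continuous_on_mult continuous_on_matrix_inv inv
        smooth_on_imp_continuous_on[OF hs] smooth_on_imp_continuous_on[OF smooth_on_wirtinger] open_T hs)
  then show ?thesis
    using continuous_on_compose2[OF _ smooth_on_imp_continuous_on[OF smooth_F] maps] by blast
qed

text \<open>The pluriharmonic equation is bilinear in \<partial> f and \<partial>-bar f. Regarding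
  one factor as a known coefficient makes it linear in the other; for \<open>s = - \<i>\<close> the
  two derivatives on the left are exchanged first.\<close>

lemma wirtinger_system:
  assumes s: "s = \<i> \<or> s = - \<i>"
  obtains C where "\<And>\<alpha> i j. continuous_on S (C \<alpha> i j)"
    and "\<And>z \<alpha> \<beta> i. z \<in> S \<Longrightarrow> wirtinger (- s) \<alpha> (wirtinger s \<beta> (\<lambda>y. F y $ i)) z
      = (\<Sum>j\<in>UNIV. C \<alpha> i j z * wirtinger s \<beta> (\<lambda>y. F y $ j) z)"
proof -
  note cont = continuous_on_christoffel smooth_on_imp_continuous_on[OF smooth_F_wirtinger]
  show ?thesis
  proof (cases "s = \<i>")
    case True
    define C where "C \<alpha> i j z = - (\<Sum>k\<in>UNIV. christoffel h (F z) i j k * wirtinger (- \<i>) \<alpha> (\<lambda>y. F y $ k) z)" for \<alpha> i j z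
    show ?thesis
    proof (rule that[of C])
      show "continuous_on S (C \<alpha> i j)" for \<alpha> i j unfolding C_def[abs_def] by (intro continuous_intros cont)
      fix z \<alpha> \<beta> i assume "z \<in> S"
      from PH[OF this, of \<alpha> \<beta> i]
      show "wirtinger (- s) \<alpha> (wirtinger s \<beta> (\<lambda>y. F y $ i)) z = (\<Sum>j\<in>UNIV. C \<alpha> i j z * wirtinger s \<beta> (\<lambda>y. F y $ j) z)"
        unfolding True C_def dz_eq_wirtinger dzbar_eq_wirtinger
        by (simp add: eq_neg_iff_add_eq_0 sum_negf sum_distrib_left sum_distrib_right mult_ac)
    qed
  next
    case False
    then have s: "s = - \<i>" using s by simp
    define C where "C \<alpha> i k z = - (\<Sum>j\<in>UNIV. christoffel h (F z) i j k * wirtinger \<i> \<alpha> (\<lambda>y. F y $ j) z)" for \<alpha> i k z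
    show ?thesis
    proof (rule that[of C])
      show "continuous_on S (C \<alpha> i j)" for \<alpha> i j unfolding C_def[abs_def] by (intro continuous_intros cont)
      fix z \<alpha> \<beta> i assume z: "z \<in> S"
      have "wirtinger \<i> \<alpha> (wirtinger (- \<i>) \<beta> (\<lambda>y. F y $ i)) z = wirtinger (- \<i>) \<beta> (wirtinger \<i> \<alpha> (\<lambda>y. F y $ i)) z"
        by (rule wirtinger_commute[OF open_S smooth_on_nth[OF open_S smooth_F] z])
      also have "\<dots> = - (\<Sum>j\<in>UNIV. \<Sum>k\<in>UNIV. christoffel h (F z) i j k
          * wirtinger \<i> \<alpha> (\<lambda>y. F y $ j) z * wirtinger (- \<i>) \<beta> (\<lambda>y. F y $ k) z)"
        using PH[OF z, of \<beta> \<alpha> i] unfolding dz_eq_wirtinger dzbar_eq_wirtinger by (simp add: eq_neg_iff_add_eq_0)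
      also have "\<dots> = - (\<Sum>k\<in>UNIV. \<Sum>j\<in>UNIV. christoffel h (F z) i j k
          * wirtinger \<i> \<alpha> (\<lambda>y. F y $ j) z * wirtinger (- \<i>) \<beta> (\<lambda>y. F y $ k) z)"
        by (subst sum.swap) simp
      finally show "wirtinger (- s) \<alpha> (wirtinger s \<beta> (\<lambda>y. F y $ i)) z = (\<Sum>j\<in>UNIV. C \<alpha> i j z * wirtinger s \<beta> (\<lambda>y. F y $ j) z)"
        unfolding s C_def by (simp add: sum_negf sum_distrib_right)
    qed
  qed
qed

text \<open>For each fixed \<beta> the vector of derivatives \<open>wirtinger s \<beta>\<close> of
  the components solves a homogeneous linear system for the operators of the opposite type
  \<open>- s\<close>, and \<open>cr_at s\<close> says that all these vectors vanish.\<close>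

lemma cr_at_unique_continuation:
  assumes s: "s = \<i> \<or> s = - \<i>" and ball: "cball z0 R \<subseteq> S"
    and r: "0 < r" and cr: "\<And>z. z \<in> ball z0 r \<Longrightarrow> cr_at s F z" and z1: "z1 \<in> ball z0 R"
  shows "cr_at s F z1"
proof -
  obtain C where C: "\<And>\<alpha> i j. continuous_on S (C \<alpha> i j)"
    and eq: "\<And>z \<alpha> \<beta> i. z \<in> S \<Longrightarrow> wirtinger (- s) \<alpha> (wirtinger s \<beta> (\<lambda>y. F y $ i)) z
      = (\<Sum>j\<in>UNIV. C \<alpha> i j z * wirtinger s \<beta> (\<lambda>y. F y $ j) z)"
    using wirtinger_system[OF s] by blast
  have bS: "ball z0 R \<subseteq> S" using ball ball_subset_cball by blast
  have "(\<chi> i. wirtinger s \<beta> (\<lambda>y. F y $ i) z1) = 0" for \<beta>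
  proof (rule wirtinger_system_unique_continuation[where s = "- s" and C = C, OF _ _ _ _ r _ z1])
    \<comment> \<open>Written as a sum of \<open>axis\<close> vectors, the tuple inherits smoothness
      from its components through sums and bounded linear maps.\<close>
    have "smooth_on S (\<lambda>z. \<Sum>i\<in>UNIV. axis i (wirtinger s \<beta> (\<lambda>y. F y $ i) z))"
    proof (intro smooth_on_sum open_S smooth_on_bounded_linear_compose[where L = "axis _"] smooth_F_wirtinger)
      show "bounded_linear (axis i :: complex \<Rightarrow> complex^'n)" for i
        by (simp add: linear_conv_bounded_linear[symmetric] linear_iff vec_eq_iff axis_def)
    qed
    moreover have "(\<Sum>i\<in>UNIV. axis i (wirtinger s \<beta> (\<lambda>y. F y $ i) z)) = (\<chi> i. wirtinger s \<beta> (\<lambda>y. F y $ i) z)" for z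
      by (simp add: vec_eq_iff axis_def cong: if_cong)
    ultimately show "smooth_on (ball z0 R) (\<lambda>z. \<chi> i. wirtinger s \<beta> (\<lambda>y. F y $ i) z)"
      using smooth_on_subset[OF _ bS] by simp
    show "- s = \<i> \<or> - s = - \<i>" using s by auto
    show "continuous_on (cball z0 R) (C \<alpha> i j)" for \<alpha> i j by (rule continuous_on_subset[OF C ball])
    show "wirtinger (- s) \<alpha> (\<lambda>y. (\<chi> i. wirtinger s \<beta> (\<lambda>y. F y $ i) y) $ i) z
      = (\<Sum>j\<in>UNIV. C \<alpha> i j z * (\<chi> i. wirtinger s \<beta> (\<lambda>y. F y $ i) z) $ j)" if "z \<in> ball z0 R" for z \<alpha> i
      using eq[of z \<alpha> \<beta> i] bS that by auto
    show "(\<chi> i. wirtinger s \<beta> (\<lambda>y. F y $ i) z) = 0" if "z \<in> ball z0 r" for z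
    proof -
      have "F differentiable (at z)" using cr[OF that] unfolding cr_at_def differentiable_def by blast
      then show ?thesis using cr_at_iff_wirtinger[OF _ s, of F z] cr[OF that] by (simp add: vec_eq_iff)
    qed
  qed
  then have "wirtinger s \<beta> (\<lambda>y. F y $ i) z1 = 0" for \<beta> i by (simp add: vec_eq_iff)
  then show ?thesis using cr_iff[OF _ s] z1 bS by blast
qed

text \<open>A minor that is nonzero at \<open>z0\<close> stays nonzero nearby by continuity, and the
  wedge relation holds on all of \<open>S\<close>. So the other derivative vanishes on a whole ball,
  which unique continuation requires, and not merely at \<open>z0\<close>.\<close>

lemma cr_near_rank_3:
  assumes nd: "\<And>w a b c e. w \<in> T \<Longrightarrow> (\<Sum>i\<in>UNIV. \<Sum>j\<in>UNIV. \<Sum>k\<in>UNIV. \<Sum>l\<in>UNIV. curvature h w i j k l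
            * (a $ i * cnj (b $ j) - c $ i * cnj (e $ j))
            * cnj (a $ l * cnj (b $ k) - c $ l * cnj (e $ k))) = 0
        \<longleftrightarrow> (\<forall>i j. a $ i * cnj (b $ j) - c $ i * cnj (e $ j) = 0)"
    and z0: "z0 \<in> S" and rank: "3 \<le> dim (range (frechet_derivative F (at z0)))"
  obtains s r where "s = \<i> \<or> s = - \<i>" "0 < r" "ball z0 r \<subseteq> S" "\<And>z. z \<in> ball z0 r \<Longrightarrow> cr_at s F z"
proof -
  define a where "a z \<alpha> i = wirtinger \<i> \<alpha> (\<lambda>y. F y $ i) z" for z \<alpha> i
  define b where "b z \<alpha> i = wirtinger (- \<i>) \<alpha> (\<lambda>y. F y $ i) z" for z \<alpha> i
  have wedge: "a z \<beta> i * cnj (b z \<alpha> j) = a z \<alpha> i * cnj (b z \<beta> j)" if z: "z \<in> S" for z \<alpha> \<beta> i j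
  proof (rule nondegenerate_wedge[OF nd])
    show "F z \<in> T" using maps z by blast
    show "(\<Sum>j\<in>UNIV. \<Sum>l\<in>UNIV. \<Sum>s\<in>UNIV. curvature h (F z) j l s q
      * (a z \<beta> j * cnj (b z \<alpha> l) - a z \<alpha> j * cnj (b z \<beta> l)) * b z \<gamma> s) = 0" for \<alpha> \<beta> \<gamma> q
      using pluriharmonic_curvature[OF open_S open_T smooth_F maps smooth_h inv PH z]
      unfolding a_def b_def dz_eq_wirtinger dzbar_eq_wirtinger .
  qed
  \<comment> \<open>Conjugation exchanges the roles of \<open>a\<close> and \<open>b\<close>, so
    \<open>wedge_minor_zero\<close> serves both cases below.\<close>
  have wedge': "b z \<beta> i * cnj (a z \<alpha> j) = b z \<alpha> i * cnj (a z \<beta> j)" if z: "z \<in> S" for z \<alpha> \<beta> i j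
  proof -
    have "cnj (a z \<alpha> j * cnj (b z \<beta> i)) = cnj (a z \<beta> j * cnj (b z \<alpha> i))" using wedge[OF z] by simp
    then show ?thesis by (simp add: mult.commute)
  qed
  have cont: "continuous_on S (\<lambda>z. a z \<alpha> i)" "continuous_on S (\<lambda>z. b z \<alpha> i)" for \<alpha> i
    unfolding a_def b_def by (intro smooth_on_imp_continuous_on[OF smooth_F_wirtinger])+
  have near: "\<exists>r>0. ball z0 r \<subseteq> S \<and> (\<forall>z\<in>ball z0 r. \<phi> z \<noteq> 0)"
    if "continuous_on S \<phi>" "\<phi> z0 \<noteq> 0" for \<phi> :: "complex^'m \<Rightarrow> complex"
  proof -
    have "open (S \<inter> \<phi> -` (- {0}))" by (rule continuous_open_preimage[OF that(1) open_S]) auto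
    moreover have "z0 \<in> S \<inter> \<phi> -` (- {0})" using z0 that(2) by simp
    ultimately obtain r where "r > 0" "ball z0 r \<subseteq> S \<inter> \<phi> -` (- {0})"
      using open_contains_ball by metis
    then show ?thesis by (intro exI[of _ r]) auto
  qed
  have D: "frechet_derivative F (at z0) v $ i = (\<Sum>\<alpha>\<in>UNIV. b z0 \<alpha> i * v $ \<alpha> + a z0 \<alpha> i * cnj (v $ \<alpha>))" for v i
    using derivative_wirtinger[OF bounded_linear.has_derivative[OF bounded_linear_vec_nth
          smooth_on_has_derivative[OF smooth_F z0]]]
    unfolding a_def b_def dz_eq_wirtinger dzbar_eq_wirtinger .
  from rank_ge_3_minor[OF D wedge[OF z0] rank] show thesis
  proof
    assume "\<exists>\<alpha> \<beta> j k. b z0 \<alpha> j * b z0 \<beta> k \<noteq> b z0 \<beta> j * b z0 \<alpha> k"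
    then obtain \<alpha> \<beta> j k where m: "b z0 \<alpha> j * b z0 \<beta> k - b z0 \<beta> j * b z0 \<alpha> k \<noteq> 0" by auto
    have c: "continuous_on S (\<lambda>z. b z \<alpha> j * b z \<beta> k - b z \<beta> j * b z \<alpha> k)" by (intro continuous_intros cont)
    obtain r where r: "r > 0" "ball z0 r \<subseteq> S" "\<And>z. z \<in> ball z0 r \<Longrightarrow> b z \<alpha> j * b z \<beta> k - b z \<beta> j * b z \<alpha> k \<noteq> 0"
      using near[of "\<lambda>z. b z \<alpha> j * b z \<beta> k - b z \<beta> j * b z \<alpha> k", OF _ m] c by blast
    have "cr_at \<i> F z" if z: "z \<in> ball z0 r" for z
    proof -
      have zS: "z \<in> S" using r(2) z by blast
      have "a z \<gamma> i = 0" for \<gamma> i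
        by (rule wedge_minor_zero[where a = "a z" and b = "b z" and \<alpha> = \<alpha> and j = j and \<beta> = \<beta> and k = k],
            rule wedge[OF zS]) (use r(3)[OF z] in auto)
      then show ?thesis using cr_iff[OF zS] unfolding a_def by simp
    qed
    then show thesis using that[of \<i> r] r by blast
  next
    assume "\<exists>\<alpha> \<beta> j k. a z0 \<alpha> j * a z0 \<beta> k \<noteq> a z0 \<beta> j * a z0 \<alpha> k"
    then obtain \<alpha> \<beta> j k where m: "a z0 \<alpha> j * a z0 \<beta> k - a z0 \<beta> j * a z0 \<alpha> k \<noteq> 0" by auto
    have c: "continuous_on S (\<lambda>z. a z \<alpha> j * a z \<beta> k - a z \<beta> j * a z \<alpha> k)" by (intro continuous_intros cont)
    obtain r where r: "r > 0" "ball z0 r \<subseteq> S" "\<And>z. z \<in> ball z0 r \<Longrightarrow> a z \<alpha> j * a z \<beta> k - a z \<beta> j * a z \<alpha> k \<noteq> 0"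
      using near[of "\<lambda>z. a z \<alpha> j * a z \<beta> k - a z \<beta> j * a z \<alpha> k", OF _ m] c by blast
    have "cr_at (- \<i>) F z" if z: "z \<in> ball z0 r" for z
    proof -
      have zS: "z \<in> S" using r(2) z by blast
      have "b z \<gamma> i = 0" for \<gamma> i
        by (rule wedge_minor_zero[where a = "b z" and b = "a z" and \<alpha> = \<alpha> and j = j and \<beta> = \<beta> and k = k],
            rule wedge'[OF zS]) (use r(3)[OF z] in auto)
      then show ?thesis using cr_iff[OF zS] unfolding b_def by simp
    qed
    then show thesis using that[of "- \<i>" r] r by blast
  qed
qed

end

section \<open>Charts and the global argument\<close>

lemma
  assumes "is_chart X c"
  shows chart_openin: "openin X (fst c)" and chart_open: "open (snd c ` fst c)"
    and chart_inj: "inj_on (snd c) (fst c)"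
    and chart_open_image: "openin X V \<Longrightarrow> V \<subseteq> fst c \<Longrightarrow> open (snd c ` V)"
    and chart_open_preimage: "open W \<Longrightarrow> openin X {p \<in> fst c. snd c p \<in> W}"
proof -
  obtain U \<phi> where c: "c = (U, \<phi>)" by (cases c)
  have U: "openin X U" "open (\<phi> ` U)" and hom: "homeomorphic_map (subtopology X U) (top_of_set (\<phi> ` U)) \<phi>"
    using assms unfolding is_chart_def c by auto
  have top: "topspace (subtopology X U) = U"
    using openin_subset[OF U(1)] by auto
  show "openin X (fst c)" "open (snd c ` fst c)" using U by (simp_all add: c)
  show "inj_on (snd c) (fst c)" using homeomorphic_imp_injective_map[OF hom] top by (simp add: c)
  show "open (snd c ` V)" if "openin X V" "V \<subseteq> fst c"
  proof -
    have "openin (subtopology X U) V" using that U by (simp add: c openin_open_subtopology)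
    then have "openin (top_of_set (\<phi> ` U)) (\<phi> ` V)"
      using homeomorphic_imp_open_map[OF hom] unfolding open_map_def by blast
    then show ?thesis using U(2) openin_open_eq by (auto simp: c)
  qed
  show "openin X {p \<in> fst c. snd c p \<in> W}" if "open W"
  proof -
    have "openin (top_of_set (\<phi> ` U)) (\<phi> ` U \<inter> W)" using that by (simp add: openin_open_Int)
    then have "openin (subtopology X U) {p \<in> topspace (subtopology X U). \<phi> p \<in> \<phi> ` U \<inter> W}"
      using homeomorphic_imp_continuous_map[OF hom] openin_continuous_map_preimage by blast
    moreover have "{p \<in> topspace (subtopology X U). \<phi> p \<in> \<phi> ` U \<inter> W} = {p \<in> fst c. snd c p \<in> W}"
      unfolding top by (auto simp: c)
    ultimately show ?thesis using U(1) by (simp add: openin_open_subtopology)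
  qed
qed

lemma local_rep_apply:
  assumes "is_chart X c" "p \<in> fst c"
  shows "local_rep c d f (snd c p) = snd d (f p)"
  unfolding local_rep_def by (simp add: inv_into_f_f[OF chart_inj[OF assms(1)] assms(2)])

lemma local_dom_mem:
  assumes "is_chart X c" "p \<in> fst c"
  shows "snd c p \<in> local_dom c d f \<longleftrightarrow> f p \<in> fst d"
proof
  assume "snd c p \<in> local_dom c d f"
  then obtain q where q: "q \<in> fst c" "f q \<in> fst d" "snd c q = snd c p"
    unfolding local_dom_def by force
  then have "q = p" using chart_inj[OF assms(1)] assms(2) by (auto dest: inj_onD)
  then show "f p \<in> fst d" using q(2) by simp
qed (use assms in \<open>auto simp: local_dom_def\<close>)

lemma open_local_dom:
  assumes c: "is_chart X c" and d: "is_chart Y d" and f: "continuous_map X Y f"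
  shows "open (local_dom c d f)"
proof -
  have "openin X {p \<in> topspace X. f p \<in> fst d}"
    by (rule openin_continuous_map_preimage[OF f chart_openin[OF d]])
  then have "openin X (fst c \<inter> {p \<in> topspace X. f p \<in> fst d})"
    using chart_openin[OF c] by blast
  moreover have "fst c \<inter> {p \<in> topspace X. f p \<in> fst d} = fst c \<inter> f -` fst d"
    using openin_subset[OF chart_openin[OF c]] by auto
  ultimately show ?thesis unfolding local_dom_def using chart_open_image[OF c] by simp
qed

text \<open>Transition maps have complex linear derivatives, and composing with these on either side
  preserves the rule \<open>D (\<i> *s v) = s *s D v\<close>.\<close>

lemma cr_at_change_charts:
  assumes M: "complex_manifold M A" and N: "complex_manifold N B" and f: "continuous_map M N f"
    and c: "c \<in> A" "c' \<in> A" and d: "d \<in> B" "d' \<in> B"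
    and p: "p \<in> fst c" "p \<in> fst c'" "f p \<in> fst d" "f p \<in> fst d'"
    and cr: "cr_at s (local_rep c d f) (snd c p)"
  shows "cr_at s (local_rep c' d' f) (snd c' p)"
proof -
  note ch = complex_manifold.charts[OF M] and chN = complex_manifold.charts[OF N]
  obtain D where D: "(local_rep c d f has_derivative D) (at (snd c p))" "\<And>v. D (\<i> *s v) = s *s D v"
    using cr unfolding cr_at_def by blast
  have "snd c' p \<in> local_dom c' c id" using local_dom_mem[OF ch[OF c(2)] p(2), of c id] p by simp
  then obtain D1 where D1: "(local_rep c' c id has_derivative D1) (at (snd c' p))" "\<And>k v. D1 (k *s v) = k *s D1 v"
    using complex_manifold.transition[OF M c(2,1)] unfolding holomorphic_vec_on_def by blast
  have "snd d (f p) \<in> local_dom d d' id" using local_dom_mem[OF chN[OF d(1)] p(3), of d' id] p by simp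
  then obtain D2 where D2: "(local_rep d d' id has_derivative D2) (at (snd d (f p)))" "\<And>k v. D2 (k *s v) = k *s D2 v"
    using complex_manifold.transition[OF N d] unfolding holomorphic_vec_on_def by blast
  have 1: "local_rep c' c id (snd c' p) = snd c p" using local_rep_apply[OF ch[OF c(2)] p(2), of c id] by simp
  have 2: "local_rep c d f (snd c p) = snd d (f p)" by (rule local_rep_apply[OF ch[OF c(1)] p(1)])
  have "((\<lambda>x. local_rep c d f (local_rep c' c id x)) has_derivative (\<lambda>v. D (D1 v))) (at (snd c' p))"
    by (rule has_derivative_compose[OF D1(1)]) (simp only: 1 D(1))
  then have 3: "((\<lambda>x. local_rep d d' id (local_rep c d f (local_rep c' c id x))) has_derivative (\<lambda>v. D2 (D (D1 v)))) (at (snd c' p))"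
    by (rule has_derivative_compose) (simp only: 1 2 D2(1))
  \<comment> \<open>On \<open>V\<close> all four charts apply at once, so there the composite
    through the old charts agrees with the new representative; its image is an open set around the
    point, as needed to transfer the derivative.\<close>
  define V where "V = (fst c \<inter> fst c') \<inter> ({q \<in> topspace M. f q \<in> fst d} \<inter> {q \<in> topspace M. f q \<in> fst d'})"
  have "openin M V" unfolding V_def
    by (intro openin_Int chart_openin ch c openin_continuous_map_preimage[OF f] chN d)
  then have oV: "open (snd c' ` V)" by (rule chart_open_image[OF ch[OF c(2)]]) (auto simp: V_def)
  have pV: "snd c' p \<in> snd c' ` V"
    using p openin_subset[OF chart_openin[OF ch[OF c(1)]]] unfolding V_def by auto
  have "(local_rep c' d' f has_derivative (\<lambda>v. D2 (D (D1 v)))) (at (snd c' p))"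
  proof (rule has_derivative_transform_within_open[OF 3 oV pV])
    fix x assume "x \<in> snd c' ` V"
    then obtain q where q: "x = snd c' q" "q \<in> fst c" "q \<in> fst c'" "f q \<in> fst d" "f q \<in> fst d'"
      unfolding V_def by blast
    show "local_rep d d' id (local_rep c d f (local_rep c' c id x)) = local_rep c' d' f x"
      unfolding q(1) local_rep_apply[OF ch[OF c(2)] q(3)]
      using local_rep_apply[OF ch[OF c(1)] q(2), of d f] local_rep_apply[OF chN[OF d(1)] q(4), of d' id] by simp
  qed
  then show ?thesis unfolding cr_at_def using D(2) D1(2) D2(2) by auto
qed

section \<open>Globalisation by connectedness\<close>

theorem theorem1p4:
  fixes M :: "'a topology" and A :: "('a, 'm::finite) chart set"
    and N :: "'b topology" and B :: "('b, 'n::finite) chart set"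
    and g :: "('b, 'n) metric" and f :: "'a \<Rightarrow> 'b"
  assumes "complex_manifold M A" and "compact_space M"
    and "kaehler_manifold N B g" and "compact_space N"
    and "smooth_map M A N B f" and "pluriharmonic A B g f"
    and "nondegenerate_curvature B g"
    and "real_rank A B f \<ge> 4"
  shows "holomorphic_map M A N B f \<or> antiholomorphic_map M A N B f"
proof -
  note M = assms(1)
  have N: "complex_manifold N B" using assms(3) by (simp add: kaehler_manifold_def)
  have f: "continuous_map M N f" using assms(5) unfolding smooth_map_def by blast
  note ch = complex_manifold.charts[OF M] and chN = complex_manifold.charts[OF N]
  have rep: "pluriharmonic_rep (local_dom c d f) (snd d ` fst d) (local_rep c d f) (g d)"
    if c: "c \<in> A" and d: "d \<in> B" for c d
  proof
    show "open (local_dom c d f)" by (rule open_local_dom[OF ch[OF c] chN[OF d] f])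
    show "open (snd d ` fst d)" by (rule chart_open[OF chN[OF d]])
    show "smooth_on (local_dom c d f) (local_rep c d f)" using assms(5) c d unfolding smooth_map_def by blast
    show "smooth_on (snd d ` fst d) (g d)" by (rule kaehler_manifold.smooth[OF assms(3) d])
    show "local_rep c d f ` local_dom c d f \<subseteq> snd d ` fst d"
      using local_rep_apply[OF ch[OF c], of _ d f] unfolding local_dom_def by auto
    show "invertible (g d w)" if "w \<in> snd d ` fst d" for w
      by (rule invertible_positive) (rule kaehler_manifold.positive[OF assms(3) d that])
    show "dz \<alpha> (dzbar \<beta> (\<lambda>y. local_rep c d f y $ i)) z
        + (\<Sum>j\<in>UNIV. \<Sum>k\<in>UNIV. christoffel (g d) (local_rep c d f z) i j k
          * dzbar \<beta> (\<lambda>y. local_rep c d f y $ j) z * dz \<alpha> (\<lambda>y. local_rep c d f y $ k) z) = 0"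
      if "z \<in> local_dom c d f" for z \<alpha> \<beta> i
      using assms(6) c d that unfolding pluriharmonic_def Let_def by blast
  qed
  have charts_at: "\<exists>c\<in>A. \<exists>d\<in>B. p \<in> fst c \<and> f p \<in> fst d" if "p \<in> topspace M" for p
  proof -
    have "f p \<in> topspace N" using f that by (auto simp: continuous_map_def)
    then show ?thesis using that complex_manifold.cover[OF M] complex_manifold.cover[OF N] by blast
  qed
  \<comment> \<open>All pairs of charts are required, so that the property belongs to the point
    \<open>q\<close>; by \<open>crI\<close> a single pair suffices to establish it.\<close>
  define cr where "cr s q \<longleftrightarrow> (\<forall>c\<in>A. \<forall>d\<in>B. q \<in> fst c \<longrightarrow> f q \<in> fst d \<longrightarrow> cr_at s (local_rep c d f) (snd c q))" for s q
  have crI: "cr s q" if "c \<in> A" "d \<in> B" "q \<in> fst c" "f q \<in> fst d" "cr_at s (local_rep c d f) (snd c q)" for s q c d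
    unfolding cr_def using cr_at_change_charts[OF M N f _ _ _ _ _ _ _ _ that(5)] that by blast
  have dom_mem: "q \<in> fst c \<Longrightarrow> snd c q \<in> local_dom c d f \<Longrightarrow> f q \<in> fst d" if "c \<in> A" for c d q
    using local_dom_mem[OF ch[OF that]] by blast
  \<comment> \<open>The interior of the set where \<open>cr s\<close> holds. Taking the interior
    provides the ball of vanishing from which unique continuation starts.\<close>
  define Z where "Z s = {p \<in> topspace M. \<exists>V. openin M V \<and> p \<in> V \<and> (\<forall>q\<in>V. cr s q)}" for s
  have Z_nbhd: "V \<subseteq> Z s" if "openin M V" "\<And>q. q \<in> V \<Longrightarrow> cr s q" for V s
    using that openin_subset[OF that(1)] unfolding Z_def by blast
  have Z_open: "openin M (Z s)" for s
  proof (subst openin_subopen, intro ballI)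
    fix p assume "p \<in> Z s"
    then obtain V where V: "openin M V" "p \<in> V" "\<forall>q\<in>V. cr s q" unfolding Z_def by blast
    then show "\<exists>T. openin M T \<and> p \<in> T \<and> T \<subseteq> Z s" using Z_nbhd[of V s] by blast
  qed
  \<comment> \<open>A neighbourhood that either misses \<open>Z s\<close> or lies inside it: this
    makes the complement of \<open>Z s\<close> open, hence \<open>Z s\<close> closed as well as
    open.\<close>
  have local: "\<exists>V. openin M V \<and> p \<in> V \<and> (V \<inter> Z s \<noteq> {} \<longrightarrow> V \<subseteq> Z s)"
    if p: "p \<in> topspace M" and s: "s = \<i> \<or> s = - \<i>" for p s
  proof -
    obtain c d where c: "c \<in> A" "p \<in> fst c" and d: "d \<in> B" "f p \<in> fst d" using charts_at[OF p] by blast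
    interpret pluriharmonic_rep "local_dom c d f" "snd d ` fst d" "local_rep c d f" "g d"
      by (rule rep[OF c(1) d(1)])
    have "snd c p \<in> local_dom c d f" using local_dom_mem[OF ch[OF c(1)] c(2)] d by blast
    then obtain e where e: "e > 0" "cball (snd c p) e \<subseteq> local_dom c d f"
      using open_S open_contains_cball by blast
    \<comment> \<open>Unique continuation is centred at the point \<open>q0\<close> of
      \<open>Z s\<close> instead of \<open>p\<close>. The ball of radius \<open>2 * R\<close> about
      \<open>q0\<close> contains the coordinates of all points of \<open>V\<close>, and its closure
      stays within \<open>3 * R = e\<close> of \<open>p\<close>.\<close>
    define R where "R = e / 3"
    have R: "R > 0" "e = 3 * R" using e unfolding R_def by auto
    define V where "V = {q \<in> fst c. snd c q \<in> ball (snd c p) R}"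
    have V: "openin M V" unfolding V_def by (rule chart_open_preimage[OF ch[OF c(1)] open_ball])
    have "V \<subseteq> Z s" if q0: "q0 \<in> V" "q0 \<in> Z s" for q0
    proof (rule Z_nbhd[OF V])
      obtain V0 where V0: "openin M V0" "q0 \<in> V0" "\<And>q. q \<in> V0 \<Longrightarrow> cr s q" using q0(2) unfolding Z_def by blast
      define V1 where "V1 = V0 \<inter> V"
      have "open (snd c ` V1)" unfolding V1_def
        by (rule chart_open_image[OF ch[OF c(1)] openin_Int[OF V0(1) V]]) (auto simp: V_def)
      moreover have "snd c q0 \<in> snd c ` V1" using V0 q0 unfolding V1_def by blast
      ultimately obtain r where r: "r > 0" "ball (snd c q0) r \<subseteq> snd c ` V1" using open_contains_ball by metis
      have in_dom: "f q \<in> fst d" if "q \<in> V" for q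
      proof (rule dom_mem[OF c(1)])
        show "q \<in> fst c" using that unfolding V_def by blast
        have "snd c q \<in> cball (snd c p) e" using that R unfolding V_def by auto
        then show "snd c q \<in> local_dom c d f" using e by blast
      qed
      fix q assume q: "q \<in> V"
      have dq0: "dist (snd c p) (snd c q0) < R" and dq: "dist (snd c p) (snd c q) < R"
        using q0 q unfolding V_def by auto
      have "cr_at s (local_rep c d f) (snd c q)"
      proof (rule cr_at_unique_continuation[OF s _ r(1)])
        show "cball (snd c q0) (2 * R) \<subseteq> local_dom c d f"
        proof
          fix x assume "x \<in> cball (snd c q0) (2 * R)"
          then have "dist (snd c p) x \<le> e" using dq0 dist_triangle[of "snd c p" x "snd c q0"] R by simp
          then show "x \<in> local_dom c d f" using e by auto
        qed
        show "snd c q \<in> ball (snd c q0) (2 * R)"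
          using dq dq0 dist_triangle[of "snd c q0" "snd c q" "snd c p"] by (simp add: dist_commute)
        fix z assume "z \<in> ball (snd c q0) r"
        then obtain q' where q': "z = snd c q'" "q' \<in> V0" "q' \<in> V" using r unfolding V1_def by blast
        then show "cr_at s (local_rep c d f) z"
          using V0(3)[OF q'(2)] in_dom[OF q'(3)] c d unfolding cr_def V_def by blast
      qed
      then show "cr s q" using crI c d in_dom[OF q] q unfolding V_def by blast
    qed
    moreover have "p \<in> V" unfolding V_def using c R by simp
    ultimately show ?thesis using V by blast
  qed
  have all: "Z s = topspace M" if s: "s = \<i> \<or> s = - \<i>" and ne: "Z s \<noteq> {}" for s
  proof -
    have sub: "Z s \<subseteq> topspace M" unfolding Z_def by blast
    have "openin M (topspace M - Z s)"
    proof (subst openin_subopen, intro ballI)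
      fix p assume p: "p \<in> topspace M - Z s"
      then obtain V where "openin M V" "p \<in> V" "V \<inter> Z s \<noteq> {} \<longrightarrow> V \<subseteq> Z s" using local[OF _ s] by blast
      then show "\<exists>T. openin M T \<and> p \<in> T \<and> T \<subseteq> topspace M - Z s"
        using p openin_subset by (intro exI[of _ V]) blast
    qed
    then have "closedin M (Z s)" using sub unfolding closedin_def by blast
    then show ?thesis
      using complex_manifold.connected[OF M] Z_open ne unfolding connected_space_clopen_in by blast
  qed
  have "\<exists>c\<in>A. \<exists>d\<in>B. \<exists>z\<in>local_dom c d f. 3 \<le> dim (range (frechet_derivative (local_rep c d f) (at z)))"
  proof (rule ccontr)
    define X where "X = {dim (range (frechet_derivative (local_rep c d f) (at z))) | c d z.
            c \<in> A \<and> d \<in> B \<and> z \<in> local_dom c d f}"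
    assume "\<not> ?thesis"
    then have le: "x \<le> 3" if "x \<in> X" for x using that unfolding X_def by force
    \<comment> \<open>The empty set is treated separately: \<open>cSup_least\<close> needs an
      element, and on natural numbers the supremum of the empty set is 0.\<close>
    have "Sup X \<le> 3"
    proof (cases "X = {}")
      case True
      then show ?thesis by (simp add: Sup_nat_def)
    next
      case False
      then show ?thesis by (rule cSup_least) (rule le)
    qed
    then show False using assms(8) unfolding real_rank_def X_def by simp
  qed
  then obtain c d z where c: "c \<in> A" and d: "d \<in> B" and z: "z \<in> local_dom c d f"
    and rank: "3 \<le> dim (range (frechet_derivative (local_rep c d f) (at z)))" by blast
  interpret pluriharmonic_rep "local_dom c d f" "snd d ` fst d" "local_rep c d f" "g d"
    by (rule rep[OF c d])
  obtain s r where s: "s = \<i> \<or> s = - \<i>" and r: "0 < r" "ball z r \<subseteq> local_dom c d f"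
    and crz: "\<And>y. y \<in> ball z r \<Longrightarrow> cr_at s (local_rep c d f) y"
  proof (rule cr_near_rank_3[OF _ z rank])
    show "((\<Sum>i\<in>UNIV. \<Sum>j\<in>UNIV. \<Sum>k\<in>UNIV. \<Sum>l\<in>UNIV. curvature (g d) w i j k l
            * (a $ i * cnj (b $ j) - c $ i * cnj (e $ j))
            * cnj (a $ l * cnj (b $ k) - c $ l * cnj (e $ k))) = 0)
        = (\<forall>i j. a $ i * cnj (b $ j) - c $ i * cnj (e $ j) = 0)" if "w \<in> snd d ` fst d" for w a b c e
      using assms(7) d that unfolding nondegenerate_curvature_def by blast
  qed blast
  obtain p where p: "p \<in> fst c" "z = snd c p" using z unfolding local_dom_def by blast
  have "{q \<in> fst c. snd c q \<in> ball z r} \<subseteq> Z s"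
  proof (rule Z_nbhd[OF chart_open_preimage[OF ch[OF c] open_ball]])
    fix q assume q: "q \<in> {q \<in> fst c. snd c q \<in> ball z r}"
    then have "f q \<in> fst d" using dom_mem[OF c, of q d] r by blast
    then show "cr s q" using crI[OF c d] crz q by blast
  qed
  \<comment> \<open>The point of large rank shows that \<open>Z s\<close> is nonempty, which starts
    the connectedness argument for this particular \<open>s\<close>.\<close>
  moreover have "p \<in> {q \<in> fst c. snd c q \<in> ball z r}" using p r by simp
  ultimately have Z: "Z s = topspace M" using all[OF s] by blast
  have cr_all: "cr_at s (local_rep c d f) z" if c: "c \<in> A" and d: "d \<in> B" and z: "z \<in> local_dom c d f" for c d z
  proof -
    obtain p where p: "p \<in> fst c" "f p \<in> fst d" "z = snd c p" using z unfolding local_dom_def by blast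
    have "p \<in> Z s" using p openin_subset[OF chart_openin[OF ch[OF c]]] unfolding Z by blast
    then show ?thesis using p c d unfolding Z_def cr_def by blast
  qed
  have deriv: "\<exists>D. (local_rep c d f has_derivative D) (at z)
      \<and> (\<forall>k v. D (k *s v) = (complex_of_real (Re k) + complex_of_real (Im k) * s) *s D v)"
    if "c \<in> A" "d \<in> B" "z \<in> local_dom c d f" for c d z
    using cr_all[OF that] cr_at_scale unfolding cr_at_def by blast
  have id: "complex_of_real (Re k) + complex_of_real (Im k) * \<i> = k"
    and conj: "complex_of_real (Re k) + complex_of_real (Im k) * (- \<i>) = cnj k" for k
    by (simp_all add: complex_eq_iff)
  from s show ?thesis
  proof
    assume "s = \<i>"
    then show ?thesis using deriv f unfolding holomorphic_map_def holomorphic_vec_on_def by (simp only: id) blast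
  next
    assume "s = - \<i>"
    then show ?thesis using deriv f unfolding antiholomorphic_map_def antiholomorphic_vec_on_def by (simp only: conj) blast
  qed
qed

end
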